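(* Let $R$ be a Zhou nil-clean ring of bounded index. Then for every $n\in\mathbb{N}$, $n\ge 1$, every matrix $A\in M_n(R)$ is the sum of two tripotents and a nilpotent; that is, there exist $E,F,W\in M_n(R)$ with $E^3=E$, $F^3=F$, $W$ nilpotent and $A=E+F+W$.
   Context: All rings are associative with identity (not necessarily commutative). $M_n(R)$ is the ring of $n\times n$ matrices over $R$. An element $a$ of a ring is tripotent if $a=a^3$. A ring $R$ is Zhou nil-clean if every element of $R$ is the sum of two tripotents and a nilpotent that commute with one another (i.e. every $a\in R$ can be written $a=e+f+w$ with $e^3=e$, $f^3=f$, $w$ nilpotent, and $e,f,w$ pairwise commuting). A ring $R$ is of bounded index if there exists $m\in\mathbb{N}$ such that $x^m=0$ for all nilpotent $x\in R$. No commutation among the matrices $E,F,W$ in the conclusion is asserted. *)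

theory Defs
  imports "Jordan_Normal_Form.Matrix"
begin

text \<open>
  Rings with identity are rendered by the sort \<open>{ring, monoid_mult}\<close> instead of \<open>ring_1\<close>:
  the latter additionally requires \<open>0 \<noteq> 1\<close> and hence excludes the zero ring.
\<close>

definition tripotent :: "'a::monoid_mult \<Rightarrow> bool" where
  "tripotent a \<longleftrightarrow> a = a ^ 3"

definition nilpotent :: "'a::{ring,monoid_mult} \<Rightarrow> bool" where
  "nilpotent a \<longleftrightarrow> (\<exists>m. a ^ m = 0)"

definition zhou_nil_clean :: "'a::{ring,monoid_mult} itself \<Rightarrow> bool" where
  "zhou_nil_clean _ \<longleftrightarrow>
     (\<forall>a::'a. \<exists>e f w. tripotent e \<and> tripotent f \<and> nilpotent w \<and>
        e * f = f * e \<and> e * w = w * e \<and> f * w = w * f \<and> a = e + f + w)"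

definition bounded_index :: "'a::{ring,monoid_mult} itself \<Rightarrow> bool" where
  "bounded_index _ \<longleftrightarrow> (\<exists>m::nat. \<forall>x::'a. nilpotent x \<longrightarrow> x ^ m = 0)"

text \<open>
  The type of matrices of all sizes is not a \<open>monoid_mult\<close>, and the library's \<open>pow_mat\<close> requires
  entries in a \<open>semiring_1\<close> (so, again, \<open>0 \<noteq> 1\<close>); hence powers, tripotents and nilpotents
  of the ring \<open>carrier_mat n n\<close> are introduced separately.
\<close>

definition mat_power :: "nat \<Rightarrow> 'a::{ring,monoid_mult} mat \<Rightarrow> nat \<Rightarrow> 'a mat" where
  "mat_power n A k = ((*) A ^^ k) (1\<^sub>m n)"

definition mat_tripotent :: "nat \<Rightarrow> 'a::{ring,monoid_mult} mat \<Rightarrow> bool" where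
  "mat_tripotent n A \<longleftrightarrow> A = mat_power n A 3"

definition mat_nilpotent :: "nat \<Rightarrow> 'a::{ring,monoid_mult} mat \<Rightarrow> bool" where
  "mat_nilpotent n A \<longleftrightarrow> (\<exists>m. mat_power n A m = 0\<^sub>m n n)"

end

theory Submission
  imports Defs "Berlekamp_Zassenhaus.Finite_Field" "HOL-Library.Function_Algebras"
begin

text \<open>
Let \<open>R\<close> be the ring and \<open>N\<close> its prime radical, the intersection of all prime ideals. The
theorem holds because modulo \<open>N\<close> the ring is a ring of functions with values in the fields with
2, 3 and 5 elements, because over such a field there is an explicit decomposition, and because the
idempotents occurring in it can be lifted along \<open>N\<close>.

Three facts make \<open>N\<close> manageable. It is locally nilpotent: if a finite set \<open>T\<close> has nonzero words
of every length, an ideal maximal with the property of missing some word of every length is prime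
and does not contain \<open>T\<close> (\<open>exists_prime_ideal_avoiding_words\<close>). It contains every
nil right ideal of bounded index (\<open>prime_ideal_contains_nil_right_ideal\<close>). Finally, in a Zhou
nil-clean ring every \<open>x\<^sup>5 - x\<close> is nilpotent, which excludes \<open>2\<times>2\<close> matrix units
(\<open>no_matrix_units\<close>); since a nilpotent \<open>x\<close> with a non-nilpotent multiple \<open>x y\<close> would produce
such matrix units, nilpotent elements generate nil right ideals and hence lie in \<open>N\<close>.

Therefore \<open>x\<^sup>5 - x\<close> and 120 lie in every prime ideal \<open>P\<close>, and this forces \<open>R / P\<close> to be a prime
field of characteristic 2, 3 or 5 (\<open>prime_ideal_residue_field\<close>). There every element is a sum
\<open>c + c'\<close> with \<open>c = \<plusminus>1\<close> and \<open>c' \<in> {0, 1, -1}\<close>. A matrix over a field becomes block triangular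
with companion blocks in a suitable basis. The last column of a companion block, with its
diagonal entry replaced by \<open>c\<close>, is \<open>c\<close> times an idempotent; the remaining \<open>c'\<close> on the diagonal is
a tripotent; and the rest of the matrix is nilpotent (\<open>companion_decomposition\<close>).

Only finitely many residue patterns of the entries of a matrix \<open>A\<close> over \<open>R\<close> exist, so the
decompositions belonging to them can be interpolated (\<open>residue_interpolation\<close>): this gives matrices
\<open>X\<^sub>1, X\<^sub>2, Y\<^sub>1, Y\<^sub>2, W\<close> over \<open>R\<close> such that \<open>A \<equiv> X\<^sub>1 - X\<^sub>2 + Y\<^sub>1 - Y\<^sub>2 + W\<close>
modulo \<open>N\<close>, where \<open>W\<close> is nilpotent modulo \<open>N\<close> and \<open>X\<^sub>1, X\<^sub>2\<close> as well as \<open>Y\<^sub>1, Y\<^sub>2\<close> are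
orthogonal idempotents modulo \<open>N\<close>. Matrices over \<open>N\<close> are nilpotent, so both pairs lift to orthogonal
idempotents, whose differences \<open>E\<close> and \<open>F\<close> are tripotent, and \<open>A - E - F\<close> is nilpotent.
Pairs of idempotents are lifted, and not their differences, because a tripotent modulo \<open>N\<close> need not
lift to a tripotent when 2 is not invertible.
\<close>

section \<open>Prime ideals and nil right ideals of bounded index\<close>

definition two_sided_ideal :: "'a::ring_1 set \<Rightarrow> bool" where
  "two_sided_ideal I \<longleftrightarrow> 0 \<in> I \<and> (\<forall>x\<in>I. \<forall>y\<in>I. x + y \<in> I) \<and> (\<forall>x\<in>I. \<forall>r. r * x \<in> I \<and> x * r \<in> I)"

definition prime_ideal :: "'a::ring_1 set \<Rightarrow> bool" where
  "prime_ideal P \<longleftrightarrow> two_sided_ideal P \<and> 1 \<notin> P \<and> (\<forall>a b. (\<forall>r. a * r * b \<in> P) \<longrightarrow> a \<in> P \<or> b \<in> P)"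

lemma ideal_zero: "two_sided_ideal I \<Longrightarrow> 0 \<in> I"
  and ideal_add: "two_sided_ideal I \<Longrightarrow> x \<in> I \<Longrightarrow> y \<in> I \<Longrightarrow> x + y \<in> I"
  and ideal_mult_left: "two_sided_ideal I \<Longrightarrow> x \<in> I \<Longrightarrow> r * x \<in> I"
  and ideal_mult_right: "two_sided_ideal I \<Longrightarrow> x \<in> I \<Longrightarrow> x * r \<in> I"
  by (auto simp: two_sided_ideal_def)

lemma ideal_uminus: "two_sided_ideal I \<Longrightarrow> x \<in> I \<Longrightarrow> - x \<in> I"
  using ideal_mult_left[of I x "-1"] by simp

lemma ideal_diff: "two_sided_ideal I \<Longrightarrow> x \<in> I \<Longrightarrow> y \<in> I \<Longrightarrow> x - y \<in> I"
  using ideal_add[of I x "- y"] ideal_uminus[of I y] by simp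

lemma ideal_sum: "two_sided_ideal I \<Longrightarrow> (\<And>i. i \<in> S \<Longrightarrow> f i \<in> I) \<Longrightarrow> sum f S \<in> I"
  by (induction S rule: infinite_finite_induct) (auto intro: ideal_zero ideal_add)

lemma prime_ideal_ideal: "prime_ideal P \<Longrightarrow> two_sided_ideal P"
  and prime_ideal_one: "prime_ideal P \<Longrightarrow> 1 \<notin> P"
  by (auto simp: prime_ideal_def)

lemma prime_idealE:
  assumes "prime_ideal P" "a \<notin> P" "b \<notin> P"
  obtains r where "a * r * b \<notin> P"
  using assms unfolding prime_ideal_def by blast

text \<open>
Zorn's lemma applies to the ideals that miss a word of every length, because there are only
finitely many words of a given length. A maximal such ideal \<open>P\<close> is prime: if \<open>a R b \<subseteq> P\<close> with
\<open>a, b \<notin> P\<close>, then the colon ideals \<open>I\<close> and \<open>K\<close> below are strictly larger than \<open>P\<close>, so they contain all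
words of some lengths \<open>N\<close> and \<open>M\<close>, and \<open>I R K \<subseteq> P\<close> puts all words of length \<open>N + M\<close> into \<open>P\<close>.
\<close>

lemma exists_prime_ideal_avoiding_words:
  fixes T :: "'a::ring_1 set"
  assumes fin: "finite T"
    and words: "\<And>N. \<exists>w. set w \<subseteq> T \<and> length w = N \<and> prod_list w \<noteq> 0"
  obtains P where "prime_ideal P" "\<And>N. \<exists>w. set w \<subseteq> T \<and> length w = N \<and> prod_list w \<notin> P"
proof -
  define avoids where
    "avoids I \<longleftrightarrow> (\<forall>N. \<exists>w. set w \<subseteq> T \<and> length w = N \<and> prod_list w \<notin> I)" for I
  define \<A> where "\<A> = {I. two_sided_ideal I \<and> avoids I}"
  have "{0} \<in> \<A>"
    using words by (auto simp: \<A>_def avoids_def two_sided_ideal_def)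
  hence ne: "\<A> \<noteq> {}" by blast
  have chain: "\<Union>\<C> \<in> \<A>" if C: "\<C> \<noteq> {}" "subset.chain \<A> \<C>" for \<C>
  proof -
    have mem: "I \<in> \<A>" if "I \<in> \<C>" for I
      using C(2) that by (auto simp: subset.chain_def)
    have id: "two_sided_ideal (\<Union>\<C>)"
      unfolding two_sided_ideal_def
    proof (intro conjI ballI allI)
      show "0 \<in> \<Union>\<C>" using C(1) mem by (auto simp: \<A>_def two_sided_ideal_def)
    next
      fix x y assume "x \<in> \<Union>\<C>" "y \<in> \<Union>\<C>"
      then obtain I where "I \<in> \<C>" "{x, y} \<subseteq> I"
        using finite_subset_Union_chain[of "{x, y}" \<C> \<A>] C by auto
      thus "x + y \<in> \<Union>\<C>" using mem[of I] ideal_add[of I x y] by (auto simp: \<A>_def)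
    next
      fix x r assume "x \<in> \<Union>\<C>"
      thus "r * x \<in> \<Union>\<C>" "x * r \<in> \<Union>\<C>"
        using mem by (auto simp: \<A>_def two_sided_ideal_def)
    qed
    have "avoids (\<Union>\<C>)"
      unfolding avoids_def
    proof (rule ccontr)
      assume "\<not> (\<forall>N. \<exists>w. set w \<subseteq> T \<and> length w = N \<and> prod_list w \<notin> \<Union> \<C>)"
      then obtain N where N: "\<And>w. set w \<subseteq> T \<Longrightarrow> length w = N \<Longrightarrow> prod_list w \<in> \<Union>\<C>"
        by blast
      let ?W = "prod_list ` {w. set w \<subseteq> T \<and> length w = N}"
      have "finite ?W" using finite_lists_length_eq[OF fin] by simp
      moreover have "?W \<subseteq> \<Union>\<C>" using N by blast
      ultimately obtain I where I: "I \<in> \<C>" "?W \<subseteq> I"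
        using finite_subset_Union_chain[of ?W \<C> \<A>] C by blast
      from mem[OF I(1)] obtain w where "set w \<subseteq> T" "length w = N" "prod_list w \<notin> I"
        by (auto simp: \<A>_def avoids_def)
      thus False using I(2) by blast
    qed
    with id show ?thesis by (simp add: \<A>_def)
  qed
  obtain P where P: "P \<in> \<A>" and max: "\<And>X. X \<in> \<A> \<Longrightarrow> P \<subseteq> X \<Longrightarrow> X = P"
    using subset_Zorn_nonempty[OF ne chain] by blast
  have idP: "two_sided_ideal P" and avP: "avoids P" using P by (auto simp: \<A>_def)
  have big: "\<exists>N. \<forall>w. set w \<subseteq> T \<longrightarrow> length w = N \<longrightarrow> prod_list w \<in> I"
    if "two_sided_ideal I" "P \<subseteq> I" "x \<in> I" "x \<notin> P" for I x
  proof -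
    have "I \<notin> \<A>" using max[of I] that by blast
    thus ?thesis using that(1) unfolding \<A>_def avoids_def by blast
  qed
  have "a \<in> P \<or> b \<in> P" if ab: "\<And>r. a * r * b \<in> P" for a b
  proof (rule ccontr)
    assume "\<not> (a \<in> P \<or> b \<in> P)"
    hence a: "a \<notin> P" and b: "b \<notin> P" by auto
    define I where "I = {x. \<forall>r. x * r * b \<in> P}"
    define K where "K = {y. \<forall>x\<in>I. \<forall>r. x * r * y \<in> P}"
    have I: "two_sided_ideal I"
      unfolding two_sided_ideal_def I_def using idP
      by (auto simp: distrib_right mult.assoc intro: ideal_zero ideal_add ideal_mult_left)
         (metis mult.assoc)
    have K: "two_sided_ideal K"
      unfolding two_sided_ideal_def K_def using idP
      by (auto simp: distrib_left intro: ideal_zero ideal_add)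
         (metis mult.assoc ideal_mult_right)+
    have "P \<subseteq> I" "P \<subseteq> K" "a \<in> I" "b \<in> K"
      using idP ab by (auto simp: I_def K_def ideal_mult_left ideal_mult_right)
    then obtain N M where
      N: "\<And>w. set w \<subseteq> T \<Longrightarrow> length w = N \<Longrightarrow> prod_list w \<in> I" and
      M: "\<And>w. set w \<subseteq> T \<Longrightarrow> length w = M \<Longrightarrow> prod_list w \<in> K"
      using big[OF I _ _ a] big[OF K _ _ b] by blast
    obtain w where w: "set w \<subseteq> T" "length w = N + M" "prod_list w \<notin> P"
      using avP by (auto simp: avoids_def)
    have "prod_list (take N w) \<in> I" "prod_list (drop N w) \<in> K"
      using w set_take_subset[of N w] set_drop_subset[of N w] by (auto intro!: N M)
    hence "prod_list (take N w) * 1 * prod_list (drop N w) \<in> P"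
      unfolding K_def by blast
    moreover have "prod_list (take N w) * prod_list (drop N w) = prod_list w"
      by (metis append_take_drop_id prod_list.append)
    ultimately show False using w(3) by simp
  qed
  moreover have "1 \<notin> P"
    using avP unfolding avoids_def by (metis length_0_conv prod_list.Nil)
  ultimately have "prime_ideal P" using idP by (auto simp: prime_ideal_def)
  thus thesis using avP that by (auto simp: avoids_def)
qed

lemma power_sum_list_expansion:
  fixes x :: "'i \<Rightarrow> 'a::ring_1"
  assumes "finite S"
  shows "(\<Sum>i\<in>S. x i) ^ p = (\<Sum>l\<in>{l. length l = p \<and> set l \<subseteq> S}. prod_list (map x l))"
proof (induction p)
  case 0
  have "{l. length l = 0 \<and> set l \<subseteq> S} = {[]}" by auto
  thus ?case by (simp del: length_0_conv)
next
  case (Suc p)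
  let ?L = "{l. length l = p \<and> set l \<subseteq> S}"
  have im: "{l. length l = Suc p \<and> set l \<subseteq> S} = (\<lambda>(i, l). i # l) ` (S \<times> ?L)"
    by (auto simp: length_Suc_conv image_def)
  have "(\<Sum>i\<in>S. x i) ^ Suc p = (\<Sum>(i, l)\<in>S \<times> ?L. x i * prod_list (map x l))"
    by (simp add: Suc sum_product sum.cartesian_product)
  also have "\<dots> = (\<Sum>l\<in>{l. length l = Suc p \<and> set l \<subseteq> S}. prod_list (map x l))"
    unfolding im by (subst sum.reindex) (auto simp: inj_on_def intro!: sum.cong)
  finally show ?case .
qed

text \<open>
Inclusion and exclusion by induction on \<open>K\<close>: the words that use every letter of \<open>K\<close> and \<open>a\<close> are
those that use every letter of \<open>K\<close>, minus those that in addition avoid \<open>a\<close>. For \<open>K = S\<close> with \<open>p\<close>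
letters this is the full polarization of \<open>a \<mapsto> a\<^sup>p\<close>, obtained without division by \<open>p!\<close>.
\<close>

lemma multilinearization:
  fixes x :: "'i \<Rightarrow> 'a::ring_1"
  assumes P: "two_sided_ideal P" and J: "0 \<in> J" "\<And>a b. a \<in> J \<Longrightarrow> b \<in> J \<Longrightarrow> a + b \<in> J"
    and pow: "\<And>a. a \<in> J \<Longrightarrow> a ^ p \<in> P" and fin: "finite S"
    and x: "\<And>i. i \<in> S \<Longrightarrow> x i \<in> J" and K: "finite K" "K \<subseteq> S"
  shows "(\<Sum>l\<in>{l. length l = p \<and> K \<subseteq> set l \<and> set l \<subseteq> S}. prod_list (map x l)) \<in> P"
  using K fin x
proof (induction K arbitrary: S rule: finite_induct)
  case (empty S)
  have "(\<Sum>i\<in>S. x i) \<in> J"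
    using empty(2,3) by (induction S rule: finite_induct) (auto intro: J)
  hence "(\<Sum>i\<in>S. x i) ^ p \<in> P" by (rule pow)
  thus ?case unfolding power_sum_list_expansion[OF empty(2)] by simp
next
  case (insert a K S)
  let ?L = "\<lambda>K S. {l. length l = p \<and> K \<subseteq> set l \<and> set l \<subseteq> S}"
  have fin: "finite (?L K S)" for K
    using finite_lists_length_eq[OF insert.prems(2), of p]
    by (rule finite_subset[rotated]) auto
  have eq: "?L (insert a K) S = ?L K S - ?L K (S - {a})"
    by auto
  have sub: "?L K (S - {a}) \<subseteq> ?L K S"
    by auto
  have "(\<Sum>l\<in>?L (insert a K) S. prod_list (map x l)) =
      (\<Sum>l\<in>?L K S. prod_list (map x l)) - (\<Sum>l\<in>?L K (S - {a}). prod_list (map x l))"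
    unfolding eq using sum_diff[OF fin sub, of "\<lambda>l. prod_list (map x l)"] by simp
  moreover have "(\<Sum>l\<in>?L K S. prod_list (map x l)) \<in> P"
    using insert.prems by (intro insert.IH) auto
  moreover have "(\<Sum>l\<in>?L K (S - {a}). prod_list (map x l)) \<in> P"
    using insert.prems insert.hyps by (intro insert.IH) auto
  ultimately show ?case using ideal_diff[OF P] by simp
qed

text \<open>
Let \<open>q + 1\<close> be the least exponent that works and \<open>x \<in> J\<close> with \<open>x\<^sup>q \<notin> P\<close>. The elements
\<open>t\<^sub>i = x\<^sup>i r\<^sub>i x\<^bsup>q - i\<^esup>\<close> for \<open>i \<le> q\<close> satisfy \<open>t\<^sub>i t\<^sub>j \<in> P\<close> for \<open>i < j\<close>, because the powers of
\<open>x\<close> that meet in the middle have total exponent larger than \<open>q\<close>. Hence in the polarization of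
\<open>a\<^bsup>q + 1\<^esup> \<in> P\<close> only the decreasing word \<open>t\<^sub>q \<cdots> t\<^sub>0\<close> survives, so it lies in \<open>P\<close>, although
primeness allows a choice of the \<open>r\<^sub>i\<close> that keeps it outside. The exponent \<open>max 1 i\<close> in place of
\<open>i\<close> ensures \<open>t\<^sub>0 \<in> J\<close> for a right ideal \<open>J\<close>.
\<close>

lemma prime_ideal_contains_nil_right_ideal:
  fixes J :: "'a::ring_1 set"
  assumes P: "prime_ideal P" and J0: "0 \<in> J"
    and Jadd: "\<And>a b. a \<in> J \<Longrightarrow> b \<in> J \<Longrightarrow> a + b \<in> J"
    and Jmult: "\<And>a r. a \<in> J \<Longrightarrow> a * r \<in> J"
    and pow: "\<And>a. a \<in> J \<Longrightarrow> a ^ p \<in> P"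
  shows "J \<subseteq> P"
  using pow
proof (induction p)
  case 0
  thus ?case using J0 prime_ideal_one[OF P] by auto
next
  case (Suc q)
  note idP = prime_ideal_ideal[OF P]
  show ?case
  proof (cases "\<forall>a\<in>J. a ^ q \<in> P")
    case True
    thus ?thesis using Suc.IH by blast
  next
    case False
    then obtain x where x: "x \<in> J" "x ^ q \<notin> P" by blast
    have xP: "x ^ j \<in> P" if "j > q" for j
    proof -
      have "x ^ j = x ^ Suc q * x ^ (j - Suc q)"
        using that by (simp flip: power_add power_Suc)
      thus ?thesis using Suc.prems[OF x(1)] ideal_mult_right[OF idP] by metis
    qed
    have xnP: "x ^ j \<notin> P" if "j \<le> q" for j
    proof
      assume "x ^ j \<in> P"
      hence "x ^ j * x ^ (q - j) \<in> P" by (rule ideal_mult_right[OF idP])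
      thus False using x(2) that by (simp flip: power_add)
    qed
    show ?thesis
    proof (cases "q = 0")
      case True
      thus ?thesis using Suc.prems by auto
    next
      case False
      define t where "t r i = x ^ (max 1 i) * r i * x ^ (q - i)" for r :: "nat \<Rightarrow> 'a" and i
      have tJ: "t r i \<in> J" for r i
      proof -
        have "x ^ max 1 i = x * x ^ (max 1 i - 1)" by (cases "max 1 i") auto
        hence "t r i = x * (x ^ (max 1 i - 1) * r i * x ^ (q - i))"
          by (simp only: t_def mult.assoc)
        thus ?thesis using Jmult[OF x(1)] by simp
      qed
      have ascent: "prod_list (map (t r) (u @ i # j # v)) \<in> P" if "i < j" for r u i j v
      proof -
        have "t r i * t r j = x ^ max 1 i * r i * (x ^ (q - i) * x ^ (max 1 j)) * (r j * x ^ (q - j))"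
          by (simp add: t_def mult.assoc)
        also have "x ^ (q - i) * x ^ (max 1 j) \<in> P"
          unfolding power_add[symmetric] using that by (intro xP) auto
        hence "x ^ max 1 i * r i * (x ^ (q - i) * x ^ (max 1 j)) * (r j * x ^ (q - j)) \<in> P"
          by (rule ideal_mult_right[OF idP ideal_mult_left[OF idP]])
        finally have "t r i * t r j \<in> P" .
        hence "prod_list (map (t r) u) * (t r i * t r j * prod_list (map (t r) v)) \<in> P"
          by (rule ideal_mult_left[OF idP ideal_mult_right[OF idP]])
        thus ?thesis by (simp add: mult.assoc)
      qed
      \<comment> \<open>A word without an ascent in which each of the \<open>q + 1\<close> letters occurs once is decreasing.\<close>
      have noascent: "\<exists>u i j v. l = u @ i # j # v \<and> i < j"
        if l: "length l = Suc q" "set l = {..<Suc q}" "l \<noteq> rev [0..<Suc q]" for l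
      proof (rule ccontr)
        assume *: "\<not> ?thesis"
        have "distinct l" using l(1,2) by (simp add: card_distinct)
        have "sorted_wrt (\<lambda>i j. j \<le> i) l"
          unfolding sorted_wrt_iff_nth_Suc_transp[of "\<lambda>i j. j \<le> i", OF transp_on_ge]
        proof (intro allI impI)
          fix k assume k: "Suc k < length l"
          have "l = take k l @ l ! k # l ! Suc k # drop (Suc (Suc k)) l"
            using k by (metis Cons_nth_drop_Suc Suc_lessD append_take_drop_id)
          thus "l ! Suc k \<le> l ! k" using * by (meson not_le)
        qed
        hence "sorted (rev l)" by (simp add: sorted_wrt_rev)
        moreover have "distinct (rev l)" using \<open>distinct l\<close> by simp
        moreover have "set (rev l) = set [0..<Suc q]" using l(2) by (metis atLeast_upt set_rev)
        ultimately have "rev l = [0..<Suc q]"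
          by (rule sorted_distinct_set_unique[OF _ _ sorted_upt distinct_upt])
        hence "l = rev [0..<Suc q]" by (simp only: rev_swap rev_rev_ident)
        thus False using l(3) by simp
      qed
      have down: "prod_list (map (t r) (rev [0..<Suc q])) \<in> P" for r
      proof -
        let ?L = "{l. length l = Suc q \<and> {..<Suc q} \<subseteq> set l \<and> set l \<subseteq> {..<Suc q}}"
        have "(\<Sum>l\<in>?L. prod_list (map (t r) l)) \<in> P"
          by (rule multilinearization[OF idP J0 Jadd Suc.prems]) (auto intro: tJ)
        moreover have "finite ?L"
          using finite_lists_length_eq[of "{..<Suc q}" "Suc q"]
          by (rule finite_subset[rotated]) auto
        moreover have "rev [0..<Suc q] \<in> ?L" by (auto simp del: upt_Suc)
        ultimately have "prod_list (map (t r) (rev [0..<Suc q]))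
            + (\<Sum>l\<in>?L - {rev [0..<Suc q]}. prod_list (map (t r) l)) \<in> P"
          by (metis (no_types, lifting) sum.remove)
        moreover have "(\<Sum>l\<in>?L - {rev [0..<Suc q]}. prod_list (map (t r) l)) \<in> P"
        proof (rule ideal_sum[OF idP])
          fix l assume "l \<in> ?L - {rev [0..<Suc q]}"
          hence "length l = Suc q" "set l = {..<Suc q}" "l \<noteq> rev [0..<Suc q]" by blast+
          from noascent[OF this] show "prod_list (map (t r) l) \<in> P"
            using ascent by blast
        qed
        ultimately show ?thesis using ideal_diff[OF idP] by fastforce
      qed
      \<comment> \<open>The factor \<open>x ^ (q - k)\<close> is the right end of the letter \<open>t r k\<close> that is prepended next.\<close>
      have "\<exists>r. x ^ (q - k) * prod_list (map (t r) (rev [0..<k])) \<notin> P" if "1 \<le> k" "k \<le> q" for k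
        using that
      proof (induction k rule: nat_induct_at_least)
        case base
        obtain s where "x ^ q * s * x ^ q \<notin> P" using prime_idealE[OF P x(2) x(2)] .
        moreover have "x ^ (q - 1) * prod_list (map (t (\<lambda>_. s)) (rev [0..<1])) = x ^ q * s * x ^ q"
          using False by (simp add: t_def mult.assoc power_eq_if[of x q] power_commutes)
             (metis mult.assoc power_commutes)
        ultimately show ?case by metis
      next
        case (Suc k)
        then obtain r where "x ^ (q - k) * prod_list (map (t r) (rev [0..<k])) \<notin> P" by auto
        then obtain s where s: "x ^ (q - 1) * s * (x ^ (q - k) * prod_list (map (t r) (rev [0..<k]))) \<notin> P"
          using prime_idealE[OF P xnP[of "q - 1"]] by auto
        have "prod_list (map (t (r(k := s))) (rev [0..<k])) = prod_list (map (t r) (rev [0..<k]))"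
          by (intro arg_cong[of _ _ prod_list]) (auto simp: t_def)
        moreover have "x ^ (q - 1) = x ^ (q - Suc k) * x ^ (max 1 k)"
          using Suc by (simp flip: power_add)
        ultimately have "x ^ (q - Suc k) * prod_list (map (t (r(k := s))) (rev [0..<Suc k])) \<notin> P"
          using s by (simp add: t_def mult.assoc)
        thus ?case by blast
      qed
      from this[of q] obtain r where r: "prod_list (map (t r) (rev [0..<q])) \<notin> P"
        using False by auto
      then obtain s where s: "x ^ q * s * prod_list (map (t r) (rev [0..<q])) \<notin> P"
        using prime_idealE[OF P x(2)] by blast
      have "prod_list (map (t (r(q := s))) (rev [0..<q])) = prod_list (map (t r) (rev [0..<q]))"
        by (intro arg_cong[of _ _ prod_list]) (auto simp: t_def)
      moreover have "max 1 q = q" using False by simp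
      ultimately have "prod_list (map (t (r(q := s))) (rev [0..<Suc q])) \<notin> P"
        using s by (simp add: t_def)
      thus ?thesis using down by blast
    qed
  qed
qed

section \<open>Nilpotent elements of Zhou nil-clean rings\<close>

lemma commuting_power_mult_distrib:
  fixes x y :: "'a::monoid_mult"
  assumes "x * y = y * x"
  shows "(x * y) ^ n = x ^ n * y ^ n"
proof (induction n)
  case (Suc n)
  have "(x * y) ^ Suc n = x * (y * x ^ n) * y ^ n"
    using Suc by (simp add: mult.assoc)
  also have "y * x ^ n = x ^ n * y"
    using power_commuting_commutes[OF assms] by metis
  finally show ?case by (simp add: mult.assoc)
qed simp

lemma nilpotent_mult_commuting:
  assumes "nilpotent x" "x * y = y * x"
  shows "nilpotent (x * y)"
  using assms unfolding nilpotent_def by (metis commuting_power_mult_distrib mult_zero_left)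

lemma nilpotent_power_iff:
  assumes "n > 0"
  shows "nilpotent (x ^ n) \<longleftrightarrow> nilpotent x"
proof
  assume "nilpotent (x ^ n)"
  thus "nilpotent x" by (auto simp: nilpotent_def simp flip: power_mult)
next
  assume "nilpotent x"
  then obtain m where "x ^ m = 0" by (auto simp: nilpotent_def)
  hence "(x ^ n) ^ m = 0 ^ n"
    by (metis power_mult mult.commute)
  also have "\<dots> = 0" using assms by (cases n) auto
  finally show "nilpotent (x ^ n)" by (auto simp: nilpotent_def)
qed

lemma nilpotent_uminus:
  assumes "nilpotent (x :: 'a::ring_1)"
  shows "nilpotent (- x)"
  using nilpotent_mult_commuting[OF assms, of "-1"] by simp

lemma nilpotent_mult_swap:
  fixes x y :: "'a::{ring,monoid_mult}"
  assumes "nilpotent (x * y)"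
  shows "nilpotent (y * x)"
proof -
  obtain m where m: "(x * y) ^ m = 0" using assms by (auto simp: nilpotent_def)
  have "(y * x) ^ Suc k = y * (x * y) ^ k * x" for k
    by (induction k) (simp_all add: mult.assoc)
  thus ?thesis using m by (metis nilpotent_def mult_zero_left mult_zero_right)
qed

text \<open>
The binomial expansion of two commuting elements with all terms divisible by \<open>y\<close> collected in one
remainder; \<open>d\<close> is a polynomial in \<open>x\<close> and \<open>y\<close>, whence its commutation with both.
\<close>

lemma commuting_power_add:
  fixes x y :: "'a::ring_1"
  assumes xy: "x * y = y * x"
  obtains d where "(x + y) ^ n = x ^ n + y * d" "d * x = x * d" "d * y = y * d"
proof -
  have "\<exists>d. (x + y) ^ n = x ^ n + y * d \<and> d * x = x * d \<and> d * y = y * d"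
  proof (induction n)
    case 0
    show ?case by (intro exI[of _ 0]) simp
  next
    case (Suc n)
    then obtain d where d: "(x + y) ^ n = x ^ n + y * d" "d * x = x * d" "d * y = y * d" by blast
    have c: "x * (y * z) = y * (x * z)" for z using xy by (metis mult.assoc)
    have cx: "x ^ n * x = x * x ^ n" by (rule power_commutes)
    have cy: "x ^ n * y = y * x ^ n" using power_commuting_commutes[OF xy] .
    have xd: "d * (x * z) = x * (d * z)" and yd: "d * (y * z) = y * (d * z)" for z
      using d by (metis mult.assoc)+
    show ?case
      by (rule exI[of _ "x * d + x ^ n + y * d"])
         (simp add: d xy c cx cy xd yd distrib_left distrib_right mult.assoc)
  qed
  thus thesis using that by blast
qed

lemma nilpotent_add_commuting:
  fixes x y :: "'a::ring_1"
  assumes "nilpotent x" "nilpotent y" "x * y = y * x"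
  shows "nilpotent (x + y)"
proof -
  obtain m where m: "x ^ m = 0" using assms(1) by (auto simp: nilpotent_def)
  obtain d where d: "(x + y) ^ m = x ^ m + y * d" "d * y = y * d"
    using commuting_power_add[OF assms(3)] by blast
  have "nilpotent (y * d)" using nilpotent_mult_commuting[OF assms(2)] d(2) by metis
  hence "nilpotent ((x + y) ^ m)" using d(1) m by simp
  thus ?thesis unfolding nilpotent_def by (metis power_mult)
qed

lemma numeral_mult_sums:
  fixes z :: "'a::ring_1"
  shows "2 * z = z + z" "3 * z = z + z + z" "4 * z = z + z + z + z" "5 * z = z + z + z + z + z"
  by (simp_all flip: one_add_one add: numeral_Bit0 numeral_Bit1 distrib_right)

text \<open>
These are identities in the commutative ring generated by \<open>e\<close> and \<open>f\<close>. The first two give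
\<open>g\<^sup>5 - 5 g\<^sup>3 + 4 g = 0\<close>, which says that \<open>g\<close> has its spectrum in \<open>{-2, \<dots>, 2}\<close>. The third one
exhibits the factor 2 in \<open>k\<^sup>2\<close>, so that the square of \<open>g\<^sup>5 - g = 15 k\<close> is divisible by 30.
\<close>

lemma tripotent_sum_powers:
  fixes e f :: "'a::ring_1"
  assumes e: "e ^ 3 = e" and f: "f ^ 3 = f" and ef: "e * f = f * e"
  defines "g \<equiv> e + f" and "k \<equiv> e * e * f + e * f * f"
  shows "g ^ 3 = g + 3 * k" "g ^ 5 = g + 15 * k" "k * k = 2 * (e * e * f * f + e * f)"
proof -
  have e1: "e * (e * e) = e" and f1: "f * (f * f) = f"
    using e f by (simp_all add: power3_eq_cube mult.assoc)
  have e2: "e * (e * (e * z)) = e * z" and f2: "f * (f * (f * z)) = f * z"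
    and c: "f * (e * z) = e * (f * z)" for z
    using e1 f1 ef by (metis mult.assoc)+
  note rules = e1 f1 e2 f2 c ef[symmetric]
  show g3: "g ^ 3 = g + 3 * k"
    by (simp add: g_def k_def power3_eq_cube numeral_mult_sums algebra_simps rules)
  have "k * (g * g) = 4 * k"
    by (simp add: g_def k_def numeral_mult_sums algebra_simps rules)
  moreover have "g ^ 5 = g ^ 3 * (g * g)"
    by (simp add: numeral_eq_Suc mult.assoc)
  moreover have "(g + 3 * k) * (g * g) = g ^ 3 + 3 * (k * (g * g))"
    by (simp add: distrib_right power3_eq_cube mult.assoc)
  ultimately have "g ^ 5 = g + 3 * k + 3 * (4 * k)"
    using g3 by simp
  also have "3 * (4 * k) = 12 * k"
    by (simp flip: mult.assoc)
  also have "g + 3 * k + 12 * k = g + (3 + 12) * k"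
    by (simp only: distrib_right add.assoc)
  finally show "g ^ 5 = g + 15 * k" by simp
  show "k * k = 2 * (e * e * f * f + e * f)"
    by (simp add: k_def numeral_mult_sums algebra_simps rules)
qed

lemma numeral_commute: "x * numeral n = numeral n * (x :: 'a::ring_1)"
  by (metis mult_of_nat_commute of_nat_numeral)

lemma zhou_nil_cleanE:
  fixes a :: "'a::ring_1"
  assumes "zhou_nil_clean TYPE('a)"
  obtains e f w where "e ^ 3 = e" "f ^ 3 = f" "nilpotent w" "e * f = f * e"
    "e * w = w * e" "f * w = w * f" "a = e + f + w"
  using assms unfolding zhou_nil_clean_def tripotent_def by metis

text \<open>
Write \<open>3 = g + w\<close> with \<open>g\<close> a sum of two commuting tripotents and \<open>w\<close> nilpotent. The polynomial
\<open>t\<^sup>5 - 5 t\<^sup>3 + 4 t\<close> vanishes at \<open>g\<close> and takes the value 120 at 3, so 120 is a multiple of \<open>w\<close>.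
\<close>

lemma zhou_nil_clean_nilpotent_120:
  assumes "zhou_nil_clean TYPE('a::ring_1)"
  shows "nilpotent (120 :: 'a::ring_1)"
proof -
  obtain e f w :: 'a where efw: "e ^ 3 = e" "f ^ 3 = f" "nilpotent w" "e * f = f * e"
    "e * w = w * e" "f * w = w * f" "3 = e + f + w"
    using zhou_nil_cleanE[OF assms] by blast
  define g k where "g = e + f" and "k = e * e * f + e * f * f"
  note g35 = tripotent_sum_powers[OF efw(1,2,4), folded k_def g_def]
  have gw: "g * w = w * g" using efw by (simp add: g_def distrib_left distrib_right)
  have three: "3 = g + w" using efw by (simp add: g_def)
  obtain c where c: "3 ^ 5 = g ^ 5 + w * c" "c * w = w * c"
    using commuting_power_add[OF gw, of 5] three by metis
  obtain d where d: "3 ^ 3 = g ^ 3 + w * d" "d * w = w * d"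
    using commuting_power_add[OF gw, of 3] three by metis
  have "(120 :: 'a) = 3 ^ 5 - 5 * 3 ^ 3 + 4 * 3" by simp
  also have "\<dots> = (g ^ 5 + w * c) - 5 * (g ^ 3 + w * d) + 4 * (g + w)"
    using c(1) d(1) three by metis
  also have "\<dots> = (g + 15 * k + w * c) - (5 * g + 15 * k + 5 * (w * d)) + (4 * g + 4 * w)"
    unfolding g35 by (simp add: distrib_left flip: mult.assoc)
  also have "\<dots> = (g - 5 * g + 4 * g) + (w * c - w * 5 * d + w * 4)"
    by (simp only: numeral_commute[of w])
       (simp add: distrib_right left_diff_distrib mult.assoc)
  also have "g - 5 * g + 4 * g = (1 - 5 + 4) * g"
    by (simp only: distrib_right left_diff_distrib mult_1_left)
  also have "(1 - 5 + 4 :: 'a) = 0" by simp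
  also have "0 * g + (w * c - w * 5 * d + w * 4) = w * (c - 5 * d + 4)"
    by (simp add: distrib_left right_diff_distrib mult.assoc)
  finally have eq: "120 = w * (c - 5 * d + 4)" .
  have "w * (5 * d) = 5 * d * w" by (metis d(2) mult.assoc numeral_commute)
  hence "w * (c - 5 * d + 4) = (c - 5 * d + 4) * w"
    using c(2) numeral_commute[of w] by (simp add: distrib_left distrib_right left_diff_distrib right_diff_distrib)
  hence "nilpotent (w * (c - 5 * d + 4))"
    by (rule nilpotent_mult_commuting[OF efw(3)])
  thus ?thesis unfolding eq .
qed

text \<open>
For \<open>x = g + w\<close> the difference of \<open>x\<^sup>5 - x\<close> and \<open>g\<^sup>5 - g = 15 k\<close> is a multiple of \<open>w\<close>,
and \<open>(15 k)\<^sup>2\<close> is a multiple of 450, which is nilpotent since 120 divides \<open>450\<^sup>3\<close>.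
\<close>

lemma zhou_nil_clean_nilpotent_diff:
  fixes x :: "'a::ring_1"
  assumes "zhou_nil_clean TYPE('a)"
  shows "nilpotent (x ^ 5 - x)"
proof -
  obtain e f w :: 'a where efw: "e ^ 3 = e" "f ^ 3 = f" "nilpotent w" "e * f = f * e"
    "e * w = w * e" "f * w = w * f" "x = e + f + w"
    using zhou_nil_cleanE[OF assms] by blast
  define g k where "g = e + f" and "k = e * e * f + e * f * f"
  note g35 = tripotent_sum_powers[OF efw(1,2,4), folded k_def g_def]
  have gw: "g * w = w * g" using efw by (simp add: g_def distrib_left distrib_right)
  have x: "x = g + w" using efw by (simp add: g_def)
  obtain c where c: "x ^ 5 = g ^ 5 + w * c" "c * w = w * c" "c * g = g * c"
    using commuting_power_add[OF gw, of 5] x by metis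
  define l where "l = e * e * f * f + e * f"
  have "(15 * k) ^ 2 = 15 * (k * 15) * k" by (simp add: power2_eq_square mult.assoc)
  also have "k * 15 = 15 * k" by (rule numeral_commute)
  also have "15 * (15 * k) * k = 225 * (k * k)" by (simp flip: mult.assoc)
  also have "\<dots> = 450 * l" unfolding g35 l_def by (simp flip: mult.assoc)
  finally have sq: "(15 * k) ^ 2 = 450 * l" .
  obtain m where m: "(120 :: 'a) ^ m = 0"
    using zhou_nil_clean_nilpotent_120[OF assms] by (auto simp: nilpotent_def)
  have "(450 :: 'a) ^ 3 = 120 * 759375" by simp
  hence "((450 :: 'a) ^ 3) ^ m = 120 ^ m * 759375 ^ m"
    by (metis commuting_power_mult_distrib numeral_commute)
  hence "nilpotent (450 :: 'a)" using m unfolding nilpotent_def by (metis mult_zero_left power_mult)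
  hence "nilpotent (450 * l)"
    by (intro nilpotent_mult_commuting) (metis numeral_commute)+
  hence "nilpotent (15 * k)" using sq nilpotent_power_iff[of 2 "15 * k"] by simp
  hence n1: "nilpotent (g ^ 5 - g)" by (simp add: g35)
  have n2: "nilpotent (w * (c - 1))"
    using c(2) by (intro nilpotent_mult_commuting[OF efw(3)]) (simp add: algebra_simps)
  have "g * (w * (c - 1)) = w * (c - 1) * g"
    using gw c(3) by (simp add: right_diff_distrib left_diff_distrib mult.assoc) (metis mult.assoc)
  hence "w * (c - 1) * g ^ n = g ^ n * (w * (c - 1))" for n
    using power_commuting_commutes[of g] by metis
  from this[of 5] this[of 1]
  have "(g ^ 5 - g) * (w * (c - 1)) = w * (c - 1) * (g ^ 5 - g)"
    by (simp add: right_diff_distrib left_diff_distrib mult.assoc)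
  from nilpotent_add_commuting[OF n1 n2 this]
  show ?thesis using c(1) x by (simp add: algebra_simps)
qed

text \<open>
Turns nilpotency of an element that acts on \<open>g\<close> as an integer into torsion of \<open>g\<close>.
\<close>

lemma scalar_nilpotent_on_idempotent:
  fixes g y :: "'a::ring_1"
  assumes "g * y = of_int c * g" "nilpotent y"
  shows "\<exists>m. of_int (c ^ m) * g = 0"
proof -
  have "g * y ^ m = of_int (c ^ m) * g" for m
  proof (induction m)
    case (Suc m)
    have "g * y ^ Suc m = g * y ^ m * y" by (simp add: power_commutes mult.assoc)
    also have "\<dots> = of_int (c ^ m) * (of_int c * g)" using Suc assms(1) by (simp add: mult.assoc)
    finally show ?case by (metis mult.assoc of_int_mult power_Suc2)
  qed simp
  thus ?thesis using assms(2) by (metis nilpotent_def mult_zero_right)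
qed

text \<open>
The elements \<open>g, s, t, t s\<close> are the matrix units \<open>e\<^sub>1\<^sub>1, e\<^sub>1\<^sub>2, e\<^sub>2\<^sub>1, e\<^sub>2\<^sub>2\<close>, so all integral
\<open>2\<times>2\<close> matrices act. The matrix \<open>u\<close> with rows \<open>(0, -1)\<close> and \<open>(1, 1)\<close> satisfies
\<open>(u\<^sup>5 - u)\<^sup>2 = -3\<close>, and the matrix \<open>v\<close> with rows \<open>(1, -1)\<close> and \<open>(1, 1)\<close> satisfies \<open>v\<^sup>4 = -4\<close>,
hence \<open>(v\<^sup>5 - v)\<^sup>4 = (-5 v)\<^sup>4 = -2500\<close>. As both differences are nilpotent, \<open>g\<close> is annihilated by a
power of 3 and by a power of 2500, which are coprime.
\<close>

lemma no_matrix_units: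
  fixes g s t :: "'a::ring_1"
  assumes nil: "\<And>x::'a. nilpotent (x ^ 5 - x)"
    and st: "s * t = g" and gg: "g * g = g" and gs: "g * s = s" and sg: "s * g = 0"
    and gt: "g * t = 0" and tg: "t * g = t"
  shows "g = 0"
proof -
  have ss: "s * s = 0" using gs sg by (metis mult.assoc mult_zero_left)
  have tt: "t * t = 0" using gt tg by (metis mult.assoc mult_zero_right)
  have assoc: "s * (t * z) = g * z" "g * (g * z) = g * z" "g * (s * z) = s * z" "s * (g * z) = 0"
    "g * (t * z) = 0" "t * (g * z) = t * z" "s * (s * z) = 0" "t * (t * z) = 0" for z
    using st gg gs sg gt tg ss tt by (metis mult.assoc mult_zero_left)+
  note rules = st gg gs sg gt tg ss tt assoc
  have five: "z ^ 5 = z * z * (z * z) * z" for z :: 'a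
    by (simp add: numeral_eq_Suc mult.assoc)
  define u where "u = t * s + t - s"
  have uu: "u * u = t - s - g" by (simp add: u_def algebra_simps rules)
  have u4: "u * u * (u * u) = s - t - t * s" unfolding uu by (simp add: algebra_simps rules)
  have u5: "u ^ 5 - u = g + s + s - t - t - t * s"
    unfolding five u4 by (simp add: u_def algebra_simps rules)
  have "g * ((u ^ 5 - u) * (u ^ 5 - u)) = - (g + g + g)"
    unfolding u5 by (simp add: algebra_simps rules)
  also have "\<dots> = of_int (- 3) * g"
    by (simp add: numeral_mult_sums)
  finally have a: "g * (u ^ 5 - u) ^ 2 = of_int (- 3) * g" by (simp add: power2_eq_square)
  define v where "v = g - s + t + t * s"
  have vv: "v * v = t + t - s - s" by (simp add: v_def algebra_simps rules)
  have v4: "v * v * (v * v) = - (g + g + g + g + t * s + t * s + t * s + t * s)"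
    unfolding vv by (simp add: algebra_simps rules)
  have v5: "v * v * (v * v) * v = - (v + v + v + v)"
    unfolding v4 by (simp add: v_def algebra_simps rules)
  have "v ^ 5 - v = of_int (- 5) * v"
    unfolding five v5 by (simp add: numeral_mult_sums)
  hence "(v ^ 5 - v) ^ 4 = of_int ((- 5) ^ 4) * v ^ 4"
    by (metis commuting_power_mult_distrib mult_of_int_commute of_int_power)
  moreover have "v ^ 4 = v * v * (v * v)" by (simp add: numeral_eq_Suc mult.assoc)
  ultimately have "g * (v ^ 5 - v) ^ 4 = g * (of_int 625 * (- (g + g + g + g + t * s + t * s + t * s + t * s)))"
    using v4 by simp
  also have "\<dots> = of_int 625 * (g * (- (g + g + g + g + t * s + t * s + t * s + t * s)))"
    by (metis mult.assoc mult_of_int_commute)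
  also have "g * (- (g + g + g + g + t * s + t * s + t * s + t * s)) = of_int (- 4) * g"
    by (simp add: numeral_mult_sums right_diff_distrib distrib_left rules)
  finally have b: "g * (v ^ 5 - v) ^ 4 = of_int (- 2500) * g" by (simp flip: mult.assoc)
  have "nilpotent ((u ^ 5 - u) ^ 2)" "nilpotent ((v ^ 5 - v) ^ 4)"
    by (simp_all add: nil nilpotent_power_iff)
  then obtain m n where m: "of_int ((- 3) ^ m) * g = 0" and n: "of_int ((- 2500) ^ n) * g = 0"
    using scalar_nilpotent_on_idempotent[OF a] scalar_nilpotent_on_idempotent[OF b] by blast
  have "coprime (- 3 :: int) (- 2500)"
  proof (rule coprimeI)
    fix c :: int assume "c dvd - 3" "c dvd - 2500"
    hence "c dvd 833 * (- 3) - (- 2500)" by (intro dvd_diff dvd_mult)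
    thus "is_unit c" by simp
  qed
  hence "coprime ((- 3 :: int) ^ m) ((- 2500) ^ n)"
    by (auto simp only: coprime_power_left_iff coprime_power_right_iff)
  then obtain p q :: int where pq: "p * (- 3) ^ m + q * (- 2500) ^ n = 1"
    by (metis bezout_int coprime_iff_gcd_eq_1)
  have "g = of_int (p * (- 3) ^ m + q * (- 2500) ^ n) * g" by (simp only: pq of_int_1 mult_1_left)
  also have "\<dots> = of_int p * (of_int ((- 3) ^ m) * g) + of_int q * (of_int ((- 2500) ^ n) * g)"
    by (simp only: of_int_add of_int_mult distrib_right mult.assoc)
  finally show ?thesis by (simp only: m n mult_zero_right add_0)
qed

text \<open>
Newton's iteration \<open>b' = 3 b\<^sup>2 - 2 b\<^sup>3\<close> changes \<open>b\<close> by an element of \<open>K\<close> and turns the defect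
\<open>d = b\<^sup>2 - b\<close> into \<open>d\<^sup>2 (4 d - 3)\<close>. Multiples are written as repeated sums since the sort provides
no numerals, and \<open>S\<close> need not contain 1, so that the lemma applies to corners and to matrices of a
fixed size inside a larger ring.
\<close>

lemma idempotent_lifting:
  fixes b :: "'a::{ring,monoid_mult}"
  assumes Sdiff: "\<And>x y. x \<in> S \<Longrightarrow> y \<in> S \<Longrightarrow> x - y \<in> S"
    and Smult: "\<And>x y. x \<in> S \<Longrightarrow> y \<in> S \<Longrightarrow> x * y \<in> S"
    and KS: "K \<subseteq> S" and Kdiff: "\<And>x y. x \<in> K \<Longrightarrow> y \<in> K \<Longrightarrow> x - y \<in> K"
    and Kmult: "\<And>x y. x \<in> S \<Longrightarrow> y \<in> K \<Longrightarrow> x * y \<in> K \<and> y * x \<in> K"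
    and b: "b \<in> S" "b * b - b \<in> K" "nilpotent (b * b - b)"
  shows "\<exists>g\<in>S. g * g = g \<and> g - b \<in> K"
proof -
  have K0: "0 \<in> K" using Kdiff[OF b(2) b(2)] by simp
  have Kadd: "x + y \<in> K" if "x \<in> K" "y \<in> K" for x y
    using Kdiff[OF that(1) Kdiff[OF K0 that(2)]] by simp
  have Sadd: "x + y \<in> S" if "x \<in> S" "y \<in> S" for x y
    using Sdiff[OF that(1) Sdiff[OF _ that(2)], of 0] K0 KS by auto
  obtain m where m: "(b * b - b) ^ m = 0" using b(3) by (auto simp: nilpotent_def)
  have "(b * b - b) ^ (2 ^ m) = (b * b - b) ^ m * (b * b - b) ^ (2 ^ m - m)"
    by (simp flip: power_add)
  hence "(b * b - b) ^ (2 ^ m) = 0" using m by simp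
  with b(1,2) show ?thesis
  proof (induction m arbitrary: b)
    case 0
    hence "b * b = b" by simp
    thus ?case using 0 K0 by (intro bexI[of _ b]) auto
  next
    case (Suc m)
    define d where "d = b * b - b"
    define b' where "b' = b * b + b * b + b * b - b * (b * b) - b * (b * b)"
    have dK: "d \<in> K" using Suc.prems by (simp add: d_def)
    have diff: "b' - b = d - (b * d + b * d)"
      by (simp add: b'_def d_def algebra_simps)
    have defect: "b' * b' - b' = d * d * (d + d + d + d - 1 - 1 - 1)"
      by (simp add: b'_def d_def algebra_simps)
    have "b' \<in> S" unfolding b'_def using Suc.prems by (intro Sdiff Sadd Smult)
    moreover have "b' * b' - b' \<in> K"
    proof -
      have "d * d \<in> K" using dK Kmult KS by blast
      hence "d * d * d + d * d * d + d * d * d + d * d * d - d * d - d * d - d * d \<in> K"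
        using dK Kmult KS by (intro Kdiff Kadd) blast+
      also have "d * d * d + d * d * d + d * d * d + d * d * d - d * d - d * d - d * d = b' * b' - b'"
        unfolding defect by (simp add: algebra_simps)
      finally show ?thesis .
    qed
    moreover have "(b' * b' - b') ^ (2 ^ m) = 0"
    proof -
      have "(d * d) ^ (2 ^ m) = d ^ (2 ^ Suc m)" by (simp add: power_mult flip: power2_eq_square)
      also have "\<dots> = 0" using Suc.prems by (simp add: d_def)
      finally have "(d * d) ^ (2 ^ m) = 0" .
      thus ?thesis unfolding defect
        by (subst commuting_power_mult_distrib) (simp_all add: algebra_simps)
    qed
    ultimately obtain g where g: "g \<in> S" "g * g = g" "g - b' \<in> K" using Suc.IH by blast
    have "b * d \<in> K" using Kmult[OF Suc.prems(1) dK] by blast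
    hence "d - (b * d + b * d) \<in> K" using dK Kadd Kdiff by blast
    hence "(g - b') + (d - (b * d + b * d)) \<in> K" using g(3) Kadd by blast
    hence "g - b \<in> K" by (simp flip: diff)
    thus ?case using g by blast
  qed
qed

text \<open>
The factorization \<open>g = b c\<close> places the lifted idempotent in the right ideal generated by \<open>b\<close>. It is
obtained by lifting within the multiples of \<open>b\<close> by elements commuting with \<open>b\<close>.
\<close>

lemma commuting_idempotent_lifting:
  fixes b :: "'a::ring_1"
  assumes nil: "nilpotent (b * b - b)"
  obtains g c where "g * g = g" "g = b * c" "nilpotent (g - b)"
proof -
  let ?C = "{c. b * c = c * b}" and ?d = "b * b - b"
  have d: "?d * c = c * ?d" if "c \<in> ?C" for c
  proof -
    have "b * c = c * b" using that by simp
    moreover from this have "b * (c * b) = c * (b * b)" by (metis mult.assoc)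
    ultimately show ?thesis by (simp add: left_diff_distrib right_diff_distrib mult.assoc)
  qed
  have "\<exists>g\<in>(\<lambda>c. b * c) ` ?C. g * g = g \<and> g - b \<in> (\<lambda>c. ?d * c) ` ?C"
  proof (rule idempotent_lifting)
    show "x - y \<in> (\<lambda>c. b * c) ` ?C" if xy: "x \<in> (\<lambda>c. b * c) ` ?C" "y \<in> (\<lambda>c. b * c) ` ?C" for x y
    proof -
      obtain c c' where "x = b * c" "y = b * c'" "c \<in> ?C" "c' \<in> ?C" using xy by blast
      thus ?thesis by (intro image_eqI[of _ _ "c - c'"]) (auto simp: algebra_simps)
    qed
    show "x * y \<in> (\<lambda>c. b * c) ` ?C" if xy: "x \<in> (\<lambda>c. b * c) ` ?C" "y \<in> (\<lambda>c. b * c) ` ?C" for x y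
    proof -
      obtain c c' where c: "x = b * c" "y = b * c'" "b * c = c * b" "b * c' = c' * b" using xy by blast
      have "c * (b * z) = b * (c * z)" "c' * (b * z) = b * (c' * z)" for z
        using c(3,4) by (metis mult.assoc)+
      hence "c * b * c' \<in> ?C" "x * y = b * (c * b * c')"
        using c by (simp_all add: mult.assoc)
      thus ?thesis by blast
    qed
    show "(\<lambda>c. ?d * c) ` ?C \<subseteq> (\<lambda>c. b * c) ` ?C"
    proof clarify
      fix c assume c: "b * c = c * b"
      have "c * (b * z) = b * (c * z)" for z using c by (metis mult.assoc)
      with c have "?d * c = b * ((b - 1) * c)" "(b - 1) * c \<in> ?C"
        by (simp_all add: left_diff_distrib right_diff_distrib mult.assoc)
      thus "?d * c \<in> (\<lambda>c. b * c) ` ?C" by blast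
    qed
    show "x - y \<in> (\<lambda>c. ?d * c) ` ?C" if xy: "x \<in> (\<lambda>c. ?d * c) ` ?C" "y \<in> (\<lambda>c. ?d * c) ` ?C" for x y
    proof -
      obtain c c' where c: "x = ?d * c" "y = ?d * c'" "c \<in> ?C" "c' \<in> ?C" using xy by blast
      have "x - y = ?d * (c - c')" by (simp only: c right_diff_distrib)
      moreover have "c - c' \<in> ?C" using c(3,4) by (simp add: right_diff_distrib left_diff_distrib)
      ultimately show ?thesis by blast
    qed
    show "x * y \<in> (\<lambda>c. ?d * c) ` ?C \<and> y * x \<in> (\<lambda>c. ?d * c) ` ?C"
      if xy: "x \<in> (\<lambda>c. b * c) ` ?C" "y \<in> (\<lambda>c. ?d * c) ` ?C" for x y
    proof -
      obtain c c' where c: "x = b * c" "y = ?d * c'" "b * c = c * b" "b * c' = c' * b"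
        using xy by blast
      have bc: "c * (b * z) = b * (c * z)" "c' * (b * z) = b * (c' * z)" for z
        using c(3,4) by (metis mult.assoc)+
      have "b * c \<in> ?C" "b * c * c' \<in> ?C" "c' * (b * c) \<in> ?C"
        using c bc by (simp_all add: mult.assoc)
      moreover have "x * y = ?d * (b * c * c')"
      proof -
        have "x * y = b * c * ?d * c'" by (simp only: c(1,2) mult.assoc)
        also have "b * c * ?d = ?d * (b * c)" using d[of "b * c"] \<open>b * c \<in> ?C\<close> by simp
        finally show ?thesis by (simp only: mult.assoc)
      qed
      moreover have "y * x = ?d * (c' * (b * c))" by (simp only: c(1,2) mult.assoc)
      ultimately show ?thesis by blast
    qed
    show "b \<in> (\<lambda>c. b * c) ` ?C" "?d \<in> (\<lambda>c. ?d * c) ` ?C"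
      by (auto intro!: image_eqI[of _ _ 1])
  qed (rule nil)
  then obtain g c c' where g: "g * g = g" "g = b * c" "g - b = ?d * c'" "c' \<in> ?C" by blast
  have "nilpotent (?d * c')" by (rule nilpotent_mult_commuting[OF nil d[OF g(4)]])
  thus thesis using that g by metis
qed

text \<open>
If \<open>x y\<close> is not nilpotent, its fourth power is idempotent up to nilpotents, and lifting it gives a
nonzero idempotent \<open>g = x z\<close>. Replacing \<open>z\<close> by \<open>(1 - g) z\<close> changes \<open>x z\<close> only by
the nilpotent \<open>x\<^sup>2 z\<^sup>2\<close>; a correction by the inverse \<open>v\<close> of a unipotent then yields \<open>2\<times>2\<close> matrix
units with \<open>e\<^sub>1\<^sub>1 = g\<close>, which is impossible.
\<close>

lemma nil_right_ideal_step:
  fixes x :: "'a::ring_1"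
  assumes nil: "\<And>x::'a. nilpotent (x ^ 5 - x)"
    and sq: "\<And>y. nilpotent (x * x * y)"
  shows "nilpotent (x * y)"
proof -
  define b where "b = (x * y) ^ 4"
  have "b * b - b = (x * y) ^ 3 * ((x * y) ^ 5 - x * y)"
    unfolding b_def by (simp add: right_diff_distrib flip: power_add power_Suc2)
  moreover have "nilpotent (((x * y) ^ 5 - x * y) * (x * y) ^ 3)"
    by (rule nilpotent_mult_commuting[OF nil])
       (simp add: right_diff_distrib left_diff_distrib power_commutes flip: power_add)
  ultimately have "nilpotent (b * b - b)" using nilpotent_mult_swap by metis
  then obtain g c where g: "g * g = g" "g = b * c" "nilpotent (g - b)"
    by (rule commuting_idempotent_lifting)
  define z where "z = y * (x * y) ^ 3 * c * g"
  have "b = x * (y * (x * y) ^ 3)" by (simp add: b_def numeral_eq_Suc mult.assoc)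
  hence xz: "x * z = g" using g by (simp add: z_def mult.assoc)
  define n where "n = g * (x * x * z * z)"
  have gn: "g * n = n" using g(1) by (simp add: n_def flip: mult.assoc)
  have "nilpotent (x * x * z * z * g)" using sq[of "z * z * g"] by (simp add: mult.assoc)
  hence "nilpotent n" unfolding n_def by (rule nilpotent_mult_swap)
  then obtain k where k: "n ^ k = 0" by (auto simp: nilpotent_def)
  define v where "v = (\<Sum>i<k. n ^ i)"
  have "(1 - n) * v = 1 - n ^ k"
    unfolding v_def by (induction k) (simp_all add: distrib_left left_diff_distrib)
  hence v: "(1 - n) * v = 1" using k by simp
  define s where "s = g * x * (1 - g)"
  define t where "t = (1 - g) * z * v * g"
  have "g = 0"
  proof (rule no_matrix_units[OF nil])
    have idem: "(1 - g) * (1 - g) = 1 - g" using g(1) by (simp add: algebra_simps)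
    have "g * x * (1 - g) * z = g * (x * z) - g * x * (g * z)" by (simp add: algebra_simps)
    also have "g * (x * z) = g" by (simp only: xz g(1))
    also have "g * x * (g * z) = n" by (simp only: n_def xz[symmetric] mult.assoc)
    also have "g - n = g * (1 - n)" using gn by (simp add: algebra_simps)
    finally have "g * x * (1 - g) * z = g * (1 - n)" .
    moreover have "s * t = g * x * ((1 - g) * (1 - g)) * z * v * g"
      by (simp add: s_def t_def mult.assoc)
    ultimately show "s * t = g" unfolding idem using v g(1) by (metis mult.assoc mult_1_right)
    show "g * s = s" using g(1) by (simp add: s_def flip: mult.assoc)
    show "t * g = t" using g(1) by (simp add: t_def mult.assoc)
    show "s * g = 0" using g(1) by (simp add: s_def mult.assoc left_diff_distrib[of 1 g])
    have "g * (1 - g) = 0" using g(1) by (simp add: right_diff_distrib)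
    thus "g * t = 0" unfolding t_def by (metis mult.assoc mult_zero_left)
  qed (rule g(1))
  hence "nilpotent (- b)" using g(3) by simp
  hence "nilpotent b" using nilpotent_uminus by fastforce
  thus ?thesis using nilpotent_power_iff[of 4 "x * y"] by (simp add: b_def)
qed

text \<open>
Induction on \<open>m\<close> with \<open>x^(2^m) = 0\<close>, passing from \<open>x\<^sup>2\<close> to \<open>x\<close>.
\<close>

lemma nilpotent_mult_right:
  fixes x :: "'a::ring_1"
  assumes nil: "\<And>x::'a. nilpotent (x ^ 5 - x)" and x: "nilpotent x"
  shows "nilpotent (x * y)"
proof -
  obtain m where m: "x ^ m = 0" using x by (auto simp: nilpotent_def)
  have "x ^ (2 ^ m) = x ^ m * x ^ (2 ^ m - m)" by (simp flip: power_add)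
  hence "x ^ (2 ^ m) = 0" using m by simp
  thus ?thesis
  proof (induction m arbitrary: x y)
    case 0
    thus ?case by (auto simp: nilpotent_def intro: exI[of _ 1])
  next
    case (Suc m)
    have "(x * x) ^ (2 ^ m) = 0"
      using Suc.prems by (simp add: power_mult flip: power2_eq_square)
    thus ?case using nil_right_ideal_step[OF nil] Suc.IH by blast
  qed
qed

lemma nilpotent_in_prime_ideal:
  fixes x :: "'a::ring_1"
  assumes nil: "\<And>x::'a. nilpotent (x ^ 5 - x)" and bounded: "bounded_index TYPE('a)"
    and x: "nilpotent x" and P: "prime_ideal P"
  shows "x \<in> P"
proof -
  obtain m where m: "\<And>z::'a. nilpotent z \<Longrightarrow> z ^ m = 0"
    using bounded by (auto simp: bounded_index_def)
  have "range (\<lambda>y. x * y) \<subseteq> P"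
  proof (rule prime_ideal_contains_nil_right_ideal[OF P])
    show "0 \<in> range (\<lambda>y. x * y)" by (auto intro: image_eqI[of _ _ 0])
    show "a + b \<in> range (\<lambda>y. x * y)" if "a \<in> range (\<lambda>y. x * y)" "b \<in> range (\<lambda>y. x * y)" for a b
      using that by (auto simp flip: distrib_left)
    show "a * r \<in> range (\<lambda>y. x * y)" if "a \<in> range (\<lambda>y. x * y)" for a r
      using that by (auto simp: mult.assoc)
    show "a ^ m \<in> P" if "a \<in> range (\<lambda>y. x * y)" for a
    proof -
      have "a ^ m = 0" using that nilpotent_mult_right[OF nil x] m by blast
      thus ?thesis using ideal_zero[OF prime_ideal_ideal[OF P]] by simp
    qed
  qed
  hence "x * 1 \<in> P" by blast
  thus ?thesis by simp
qed

text \<open>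
Otherwise some prime ideal misses a word of length 1, that is, an element of \<open>T\<close>.
\<close>

lemma prime_radical_locally_nilpotent:
  fixes T :: "'a::ring_1 set"
  assumes "finite T" and "\<And>P x. prime_ideal P \<Longrightarrow> x \<in> T \<Longrightarrow> x \<in> P"
  obtains N where "\<And>w. set w \<subseteq> T \<Longrightarrow> length w = N \<Longrightarrow> prod_list w = 0"
proof (rule ccontr)
  assume "\<not> thesis"
  hence "\<And>N. \<exists>w. set w \<subseteq> T \<and> length w = N \<and> prod_list w \<noteq> 0" using that by blast
  then obtain P where P: "prime_ideal P"
    and w: "\<And>N. \<exists>w. set w \<subseteq> T \<and> length w = N \<and> prod_list w \<notin> P"
    using exists_prime_ideal_avoiding_words[OF assms(1)] by metis
  obtain w where "set w \<subseteq> T" "length w = 1" "prod_list w \<notin> P" using w by blast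
  moreover from this obtain a where "w = [a]" by (auto simp: length_Suc_conv)
  ultimately show False using assms(2)[OF P, of a] by simp
qed

section \<open>Residue fields and interpolation\<close>

definition cong_mod :: "'a::ring_1 set \<Rightarrow> 'a \<Rightarrow> 'a \<Rightarrow> bool" where
  "cong_mod I x y \<longleftrightarrow> x - y \<in> I"

context
  fixes I :: "'a::ring_1 set"
  assumes I: "two_sided_ideal I"
begin

lemma cong_mod_refl: "cong_mod I x x"
  using I by (simp add: cong_mod_def ideal_zero)

lemma cong_mod_sym: "cong_mod I x y \<Longrightarrow> cong_mod I y x"
  using ideal_uminus[OF I] by (fastforce simp: cong_mod_def)

lemma cong_mod_trans: "cong_mod I x y \<Longrightarrow> cong_mod I y z \<Longrightarrow> cong_mod I x z"
  using ideal_add[OF I, of "x - y" "y - z"] by (simp add: cong_mod_def)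

lemma cong_mod_add: "cong_mod I x y \<Longrightarrow> cong_mod I x' y' \<Longrightarrow> cong_mod I (x + x') (y + y')"
  using ideal_add[OF I, of "x - y" "x' - y'"] by (simp add: cong_mod_def algebra_simps)

lemma cong_mod_diff: "cong_mod I x y \<Longrightarrow> cong_mod I x' y' \<Longrightarrow> cong_mod I (x - x') (y - y')"
  using ideal_diff[OF I, of "x - y" "x' - y'"] by (simp add: cong_mod_def algebra_simps)

lemma cong_mod_mult:
  assumes "cong_mod I x y" "cong_mod I x' y'"
  shows "cong_mod I (x * x') (y * y')"
proof -
  have "(x - y) * x' + y * (x' - y') \<in> I"
    using assms by (intro ideal_add[OF I] ideal_mult_right[OF I] ideal_mult_left[OF I])
      (simp_all add: cong_mod_def)
  thus ?thesis by (simp add: cong_mod_def algebra_simps)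
qed

lemma cong_mod_power: "cong_mod I x y \<Longrightarrow> cong_mod I (x ^ n) (y ^ n)"
  by (induction n) (auto intro: cong_mod_refl cong_mod_mult)

lemma cong_mod_sum: "(\<And>i. i \<in> S \<Longrightarrow> cong_mod I (f i) (g i)) \<Longrightarrow> cong_mod I (sum f S) (sum g S)"
  by (induction S rule: infinite_finite_induct) (auto intro: cong_mod_refl cong_mod_add)

lemma cong_mod_of_int:
  assumes "of_int p \<in> I" "p dvd a - b"
  shows "cong_mod I (of_int a) (of_int b)"
proof -
  obtain k where "a - b = p * k" using assms(2) by blast
  hence "of_int a - of_int b = (of_int p * of_int k :: 'a)" by (metis of_int_diff of_int_mult)
  thus ?thesis using ideal_mult_right[OF I assms(1)] by (simp add: cong_mod_def)
qed

end

text \<open>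
Modulo \<open>P\<close> there are no elements with square zero, as \<open>x\<^sup>2 \<in> P\<close> gives \<open>x\<^sup>5 \<in> P\<close> and so \<open>x \<in> P\<close>. From
\<open>a b \<in> P\<close> it follows that \<open>b r a\<close> has its square in \<open>P\<close> for every \<open>r\<close>.
\<close>

lemma prime_ideal_completely_prime:
  fixes P :: "'a::ring_1 set"
  assumes P: "prime_ideal P" and fifth: "\<And>x. x ^ 5 - x \<in> P" and ab: "a * b \<in> P"
  shows "a \<in> P \<or> b \<in> P"
proof -
  note idP = prime_ideal_ideal[OF P]
  have sq: "x \<in> P" if "x * x \<in> P" for x
  proof -
    have "x * x * x ^ 3 \<in> P" using that by (rule ideal_mult_right[OF idP])
    also have "x * x * x ^ 3 = x ^ 5" by (simp add: numeral_eq_Suc mult.assoc)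
    finally have "x ^ 5 - (x ^ 5 - x) \<in> P" using fifth by (rule ideal_diff[OF idP])
    thus ?thesis by simp
  qed
  have "b * r * a \<in> P" for r
  proof (rule sq)
    have "b * r * (a * b) * (r * a) \<in> P"
      by (rule ideal_mult_right[OF idP ideal_mult_left[OF idP ab]])
    thus "b * r * a * (b * r * a) \<in> P" by (simp add: mult.assoc)
  qed
  thus ?thesis using P unfolding prime_ideal_def by blast
qed

text \<open>
Modulo \<open>P\<close> the ring is a domain in which \<open>x (x - 1) (x + 1) (x\<^sup>2 + 1) = 0\<close>. In characteristic 2 and
5 the last factor is a product of linear ones. In characteristic 3 it is not, but if it
vanishes at \<open>x\<close> and at \<open>x + 1\<close>, then \<open>2 x + 1 = 0\<close> and \<open>x = 1\<close>.
\<close>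

lemma prime_ideal_residue_field:
  fixes P :: "'a::ring_1 set"
  assumes P: "prime_ideal P" and fifth: "\<And>x. x ^ 5 - x \<in> P" and char: "120 \<in> P"
  obtains p :: int where "p \<in> {2, 3, 5}" "of_int p \<in> P"
    "\<And>x. \<exists>c. 0 \<le> c \<and> c < p \<and> cong_mod P x (of_int c)"
proof -
  note idP = prime_ideal_ideal[OF P]
  note dom = prime_ideal_completely_prime[OF P fifth]
  have split: "x \<in> P \<or> x - 1 \<in> P \<or> x + 1 \<in> P \<or> x * x + 1 \<in> P" for x
  proof -
    have "x ^ 5 - x = x * ((x - 1) * ((x + 1) * (x * x + 1)))"
      by (simp add: numeral_eq_Suc algebra_simps)
    hence "x * ((x - 1) * ((x + 1) * (x * x + 1))) \<in> P" using fifth[of x] by simp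
    thus ?thesis using dom by blast
  qed
  have shift: "y \<in> P" if "x \<in> P" "k \<in> P" "y = x + k * z" for x y k z
    using that by (auto intro: ideal_add[OF idP] ideal_mult_right[OF idP])
  have "(120 :: 'a) = 2 * (2 * (2 * (3 * 5)))" by simp
  hence "2 * (2 * (2 * (3 * 5))) \<in> P" using char by metis
  then consider "2 \<in> P" | "3 \<in> P" | "5 \<in> P" using dom by blast
  thus thesis
  proof cases
    case 1
    have "x \<in> P \<or> x - 1 \<in> P" for x
    proof -
      have "x - 1 \<in> P" if "x + 1 \<in> P"
        by (rule shift[OF that 1, of _ "- 1"]) simp
      moreover have "x - 1 \<in> P" if "x * x + 1 \<in> P"
      proof -
        have "(x - 1) * (x - 1) \<in> P"
          by (rule shift[OF that 1, of _ "- x"]) (simp add: algebra_simps mult_2)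
        thus ?thesis using dom by blast
      qed
      ultimately show ?thesis using split by blast
    qed
    hence "\<exists>c. 0 \<le> c \<and> c < 2 \<and> cong_mod P x (of_int c)" for x
      unfolding cong_mod_def by (metis diff_zero of_int_0 of_int_1 order_refl zero_le_one
          one_less_numeral_iff semiring_norm(76) zero_less_numeral)
    thus thesis using 1 by (intro that[of 2]) auto
  next
    case 2
    have "x \<in> P \<or> x - 1 \<in> P \<or> x - 2 \<in> P" for x
    proof -
      have x2: "x - 2 \<in> P" if "x + 1 \<in> P"
        by (rule shift[OF that 2, of _ "- 1"]) simp
      have "x - 1 \<in> P" if "x + 1 + 1 \<in> P"
        by (rule shift[OF that 2, of _ "- 1"]) simp
      moreover have "x - 1 \<in> P" if "x * x + 1 \<in> P" "(x + 1) * (x + 1) + 1 \<in> P"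
        by (rule shift[OF ideal_diff[OF idP that] 2, of _ x])
           (simp add: algebra_simps numeral_mult_sums)
      ultimately show ?thesis using split[of x] split[of "x + 1"] x2 by auto
    qed
    moreover have "\<exists>c. 0 \<le> c \<and> c < 3 \<and> cong_mod P x (of_int c)"
      if "x \<in> P \<or> x - 1 \<in> P \<or> x - 2 \<in> P" for x
      using that by (elim disjE; intro exI[of _ 0] exI[of _ 1] exI[of _ 2]) (simp_all add: cong_mod_def)
    ultimately show thesis using 2 by (intro that[of 3]) auto
  next
    case 3
    have "x \<in> P \<or> x - 1 \<in> P \<or> x - 2 \<in> P \<or> x - 3 \<in> P \<or> x - 4 \<in> P" for x
    proof -
      have "x - 4 \<in> P" if "x + 1 \<in> P"
        by (rule shift[OF that 3, of _ "- 1"]) simp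
      moreover have "x - 2 \<in> P \<or> x - 3 \<in> P" if "x * x + 1 \<in> P"
      proof -
        have "(x - 2) * (x - 3) = x * x - (x * 3 + 2 * x) + 6" by (simp add: algebra_simps)
        also have "x * 3 + 2 * x = 5 * x" by (simp add: numeral_commute[of x] flip: distrib_right)
        also have "x * x - 5 * x + 6 = x * x + 1 + 5 * (1 - x)" by (simp add: right_diff_distrib)
        finally have "(x - 2) * (x - 3) \<in> P" using shift[OF that 3] by blast
        thus ?thesis using dom by blast
      qed
      ultimately show ?thesis using split[of x] by blast
    qed
    moreover have "\<exists>c. 0 \<le> c \<and> c < 5 \<and> cong_mod P x (of_int c)"
      if "x \<in> P \<or> x - 1 \<in> P \<or> x - 2 \<in> P \<or> x - 3 \<in> P \<or> x - 4 \<in> P" for x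
      using that by (elim disjE; intro exI[of _ 0] exI[of _ 1] exI[of _ 2] exI[of _ 3] exI[of _ 4])
        (simp_all add: cong_mod_def)
    ultimately show thesis using 3 by (intro that[of 5]) auto
  qed
qed

definition has_residues :: "'a::ring_1 set \<Rightarrow> int \<Rightarrow> 'a list \<Rightarrow> int list \<Rightarrow> bool" where
  "has_residues P p as cs \<longleftrightarrow> p \<in> {2, 3, 5} \<and> of_int p \<in> P \<and>
     list_all2 (\<lambda>a c. 0 \<le> c \<and> c < p \<and> cong_mod P a (of_int c)) as cs"

text \<open>
Induction on the list. Without entries only the characteristic matters, and 15, 10, 6 are the
idempotents of \<open>\<int>/30\<close> belonging to 2, 3, 5. For a further entry \<open>a\<close>, Fermat's theorem makes
\<open>1 - (a - c)\<^sup>4\<close> the indicator function of \<open>a \<equiv> c\<close> for all three primes, since \<open>p - 1\<close> divides 4.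
The index \<open>c\<close> runs up to 4 for every \<open>p\<close>; the function \<open>h'\<close> suppresses those \<open>c \<ge> p\<close> that repeat
a residue.
\<close>

lemma residue_interpolation:
  fixes as :: "'a::ring_1 list" and h :: "int \<Rightarrow> int list \<Rightarrow> int"
  obtains r where
    "\<And>P p cs. two_sided_ideal P \<Longrightarrow> has_residues P p as cs \<Longrightarrow> cong_mod P r (of_int (h p cs))"
proof -
  have "\<exists>r. \<forall>P p cs. two_sided_ideal P \<longrightarrow> has_residues P p as cs \<longrightarrow> cong_mod P r (of_int (h p cs))"
  proof (induction as arbitrary: h)
    case Nil
    let ?r = "15 * h 2 [] + 10 * h 3 [] + 6 * h 5 []"
    have "p dvd ?r - h p []" if "p \<in> {2, 3, 5}" for p
      using that by auto
    hence "cong_mod P (of_int ?r) (of_int (h p cs))"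
      if "two_sided_ideal P" "has_residues P p [] cs" for P :: "'a set" and p cs
      using that by (intro cong_mod_of_int[of P p]) (auto simp: has_residues_def)
    thus ?case by blast
  next
    case (Cons a as)
    define h' where "h' c p cs = (if c < p then h p (c # cs) else 0)" for c p cs
    have "\<forall>c. \<exists>r. \<forall>P p cs. two_sided_ideal P \<longrightarrow> has_residues P p as cs \<longrightarrow>
        cong_mod P r (of_int (h' c p cs))"
      using Cons.IH by blast
    then obtain r where r: "\<And>c P p cs. two_sided_ideal P \<Longrightarrow> has_residues P p as cs \<Longrightarrow>
        cong_mod P (r c) (of_int (h' c p cs))"
      by metis
    let ?r = "\<Sum>c\<in>{0..4}. (1 - (a - of_int c) ^ 4) * r c"
    have "cong_mod P ?r (of_int (h p ds))"
      if P: "two_sided_ideal P" and res: "has_residues P p (a # as) ds" for P p ds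
    proof -
      obtain d cs where ds: "ds = d # cs" and p: "p \<in> {2, 3, 5}" "of_int p \<in> P"
        and d: "0 \<le> d" "d < p" "cong_mod P a (of_int d)" and cs: "has_residues P p as cs"
        using res by (auto simp: has_residues_def list_all2_Cons1)
      let ?t = "\<lambda>c. (1 - (d - c) ^ 4) * h' c p cs"
      have "cong_mod P ?r (\<Sum>c\<in>{0..4}. of_int (?t c))"
      proof (rule cong_mod_sum[OF P])
        fix c :: int
        have "cong_mod P ((1 - (a - of_int c) ^ 4) * r c)
            ((1 - (of_int d - of_int c) ^ 4) * of_int (h' c p cs))"
          by (intro cong_mod_mult cong_mod_diff cong_mod_power cong_mod_refl d r P cs)
        thus "cong_mod P ((1 - (a - of_int c) ^ 4) * r c) (of_int (?t c))" by simp
      qed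
      also have "(\<Sum>c\<in>{0..4}. of_int (?t c)) = (of_int (\<Sum>c\<in>{0..4}. ?t c) :: 'a)"
        by simp
      finally have "cong_mod P ?r (of_int (\<Sum>c\<in>{0..4}. ?t c))" .
      moreover have "p dvd (\<Sum>c\<in>{0..4}. ?t c) - h p ds"
      proof -
        have "d \<in> {0..4}" using p d by auto
        hence "(\<Sum>c\<in>{0..4}. ?t c) = ?t d + (\<Sum>c\<in>{0..4} - {d}. ?t c)"
          by (intro sum.remove) auto
        moreover have "?t d = h p ds" using d by (simp add: h'_def ds)
        moreover have "p dvd (\<Sum>c\<in>{0..4} - {d}. ?t c)"
        proof (rule dvd_sum)
          fix c assume c: "c \<in> {0..4} - {d}"
          show "p dvd ?t c"
          proof (cases "c < p")
            case True
            have "p dvd 1 - (d - c) ^ 4"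
            proof -
              have "p dvd 1 - e ^ 4"
                if "p = 2 \<and> e \<in> {-1, 1} \<or> p = 3 \<and> e \<in> {-2, -1, 1, 2}
                  \<or> p = 5 \<and> e \<in> {-4, -3, -2, -1, 1, 2, 3, 4}" for e
                using that by auto
              moreover have "p = 2 \<and> d - c \<in> {-1, 1} \<or> p = 3 \<and> d - c \<in> {-2, -1, 1, 2}
                 \<or> p = 5 \<and> d - c \<in> {-4, -3, -2, -1, 1, 2, 3, 4}"
                using p(1) d c True by auto
              ultimately show ?thesis by blast
            qed
            thus ?thesis by simp
          qed (simp add: h'_def)
        qed
        ultimately show ?thesis by simp
      qed
      ultimately show ?thesis
        using cong_mod_trans[OF P] cong_mod_of_int[OF P p(2)] by blast
    qed
    thus ?case by blast
  qed
  thus thesis using that by blast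
qed

section \<open>Linear maps over a field in a Krylov basis\<close>

definition fscale :: "'f::field \<Rightarrow> (nat \<Rightarrow> 'f) \<Rightarrow> nat \<Rightarrow> 'f" where
  "fscale c v = (\<lambda>i. c * v i)"

interpretation seq: vector_space fscale
  by unfold_locales (auto simp: fscale_def fun_eq_iff algebra_simps)

interpretation seq: vector_space_pair fscale fscale ..

abbreviation linear_on_seq :: "((nat \<Rightarrow> 'f::field) \<Rightarrow> nat \<Rightarrow> 'f) \<Rightarrow> bool" where
  "linear_on_seq \<equiv> Vector_Spaces.linear fscale fscale"

text \<open>
Vectors of length \<open>n\<close> are sequences vanishing from index \<open>n\<close> on, so that \<open>n\<close> may be arbitrary while
all vectors belong to one type.
\<close>

definition initial_space :: "nat \<Rightarrow> (nat \<Rightarrow> 'f::field) set" where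
  "initial_space n = {v. \<forall>i\<ge>n. v i = 0}"

definition unit_seq :: "nat \<Rightarrow> nat \<Rightarrow> 'f::field" where
  "unit_seq j = (\<lambda>i. if i = j then 1 else 0)"

lemma sum_apply: "(\<Sum>j\<in>S. f j) i = (\<Sum>j\<in>S. f j i :: 'a::comm_monoid_add)"
  by (induction S rule: infinite_finite_induct) (auto simp: zero_fun_def plus_fun_def)

lemma subspace_initial_space: "seq.subspace (initial_space n)"
  by (auto simp: seq.subspace_def initial_space_def fscale_def zero_fun_def plus_fun_def)

lemma initial_space_expansion:
  assumes "v \<in> initial_space n"
  shows "v = (\<Sum>j<n. fscale (v j) (unit_seq j))"
proof
  fix i
  have "(\<Sum>j<n. fscale (v j) (unit_seq j)) i = (\<Sum>j<n. if j = i then v j else 0)"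
    unfolding sum_apply fscale_def unit_seq_def by (rule sum.cong) auto
  thus "v i = (\<Sum>j<n. fscale (v j) (unit_seq j)) i"
    using assms by (auto simp: initial_space_def)
qed

lemma unit_seq_in_initial_space: "j < n \<Longrightarrow> unit_seq j \<in> initial_space n"
  by (auto simp: initial_space_def unit_seq_def)

lemma initial_space_subset_span: "initial_space n \<subseteq> seq.span (unit_seq ` {..<n})"
proof
  fix v :: "nat \<Rightarrow> 'f::field" assume "v \<in> initial_space n"
  hence "v = (\<Sum>j<n. fscale (v j) (unit_seq j))" by (rule initial_space_expansion)
  also have "\<dots> \<in> seq.span (unit_seq ` {..<n})"
    by (intro seq.span_sum seq.span_scale seq.span_base) auto
  finally show "v \<in> seq.span (unit_seq ` {..<n})" .
qed

text \<open>
Greedy construction: \<open>b\<^sub>i\<close> is followed by \<open>A b\<^sub>i\<close> as long as this is linearly independent of the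
vectors chosen so far, and by an arbitrary independent vector otherwise. A chain of maximal length
spans the space.
\<close>

lemma exists_krylov_basis:
  fixes A :: "(nat \<Rightarrow> 'f::field) \<Rightarrow> nat \<Rightarrow> 'f"
  assumes A: "\<And>v. A v \<in> initial_space n"
  shows "\<exists>b k. k \<le> n \<and> inj_on b {..<k} \<and> \<not> seq.dependent (b ` {..<k}) \<and>
    seq.span (b ` {..<k}) = initial_space n \<and>
    (\<forall>i<k. A (b i) \<in> seq.span (b ` {..i}) \<or> Suc i < k \<and> b (Suc i) = A (b i))"
proof -
  define good where "good b k \<longleftrightarrow> inj_on b {..<k} \<and> \<not> seq.dependent (b ` {..<k}) \<and>
      b ` {..<k} \<subseteq> initial_space n \<and>
      (\<forall>i. Suc i < k \<longrightarrow> A (b i) \<in> seq.span (b ` {..i}) \<or> b (Suc i) = A (b i))" for b k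
  have "good b 0" for b by (simp add: good_def seq.independent_empty)
  moreover have bound: "k \<le> n" if "good b k" for b k
  proof -
    have "card (b ` {..<k}) \<le> card (unit_seq ` {..<n} :: (nat \<Rightarrow> 'f) set)"
      using that initial_space_subset_span[of n]
      by (intro conjunct2[OF seq.independent_span_bound]) (auto simp: good_def)
    also have "\<dots> \<le> n" using card_image_le[of "{..<n}" unit_seq] by simp
    finally show ?thesis using that by (simp add: good_def card_image)
  qed
  ultimately obtain k where "\<exists>b. good b k" and max: "\<And>l. \<exists>b. good b l \<Longrightarrow> l \<le> k"
    using GreatestI_nat[of "\<lambda>k. \<exists>b. good b k" 0 n] Greatest_le_nat[of "\<lambda>k. \<exists>b. good b k" _ n]
    by blast
  then obtain b where b: "good b k" by blast
  have top: "initial_space n \<subseteq> seq.span (b ` {..<k})"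
  proof (rule ccontr)
    assume "\<not> ?thesis"
    then obtain v where v: "v \<in> initial_space n" "v \<notin> seq.span (b ` {..<k})" by blast
    define next_vec where "next_vec =
      (if k > 0 \<and> A (b (k - 1)) \<notin> seq.span (b ` {..<k}) then A (b (k - 1)) else v)"
    have nv: "next_vec \<in> initial_space n" "next_vec \<notin> seq.span (b ` {..<k})"
      using v A by (auto simp: next_vec_def)
    define b' where "b' = b(k := next_vec)"
    have im: "b' ` {..i} = b ` {..i}" if "i < k" for i
      using that by (auto simp: b'_def image_def)
    have im': "b' ` {..<k} = b ` {..<k}" by (auto simp: b'_def image_def)
    have ins: "b' ` {..<Suc k} = insert next_vec (b ` {..<k})"
      unfolding lessThan_Suc image_insert im' by (simp add: b'_def)
    have "good b' (Suc k)"
      unfolding good_def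
    proof (intro conjI allI impI)
      have "next_vec \<notin> b ` {..<k}" using nv(2) seq.span_base[of next_vec "b ` {..<k}"] by auto
      moreover have "inj_on b' {..<k}" using b by (auto simp: b'_def good_def inj_on_def)
      ultimately show "inj_on b' {..<Suc k}"
        unfolding lessThan_Suc inj_on_insert using im' by (auto simp: b'_def)
      show "\<not> seq.dependent (b' ` {..<Suc k})"
        unfolding ins using b nv(2) by (intro seq.independent_insertI) (auto simp: good_def)
      show "b' ` {..<Suc k} \<subseteq> initial_space n"
        unfolding ins using b nv(1) by (auto simp: good_def)
    next
      fix i assume i: "Suc i < Suc k"
      show "A (b' i) \<in> seq.span (b' ` {..i}) \<or> b' (Suc i) = A (b' i)"
      proof (cases "Suc i = k")
        case True
        have "b' (Suc i) = next_vec" "b' i = b i" "i < k" using True by (auto simp: b'_def)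
        moreover have "{..<k} = {..i}" using True by auto
        moreover have "next_vec = A (b i)" if "A (b i) \<notin> seq.span (b ` {..<k})"
          using that True by (auto simp: next_vec_def)
        ultimately show ?thesis using im[of i] by metis
      next
        case False
        thus ?thesis using b i im[of i] by (auto simp: b'_def good_def)
      qed
    qed
    thus False using max[of "Suc k"] by auto
  qed
  show ?thesis
  proof (intro exI[of _ b] exI[of _ k] conjI allI impI)
    show "seq.span (b ` {..<k}) = initial_space n"
      using top b seq.span_minimal[OF _ subspace_initial_space, of "b ` {..<k}" n]
      by (auto simp: good_def)
    show "A (b i) \<in> seq.span (b ` {..i}) \<or> Suc i < k \<and> b (Suc i) = A (b i)" if that: "i < k" for i
    proof (cases "Suc i = k")
      case True
      hence "{..i} = {..<k}" by auto
      thus ?thesis using top A by auto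
    next
      case False
      thus ?thesis using b that by (auto simp: good_def)
    qed
  qed (use b bound in \<open>auto simp: good_def\<close>)
qed

lemma linear_funpow:
  assumes "linear_on_seq f"
  shows "linear_on_seq (f ^^ m)"
proof (induction m)
  case 0
  show ?case using seq.linear_id by (simp add: id_def)
next
  case (Suc m)
  thus ?case using Vector_Spaces.linear_compose[OF Suc assms] by (simp only: funpow.simps)
qed

lemma linear_zero_fun: "linear_on_seq f \<Longrightarrow> f 0 = 0"
  by (rule seq.linear_0)

text \<open>
In a Krylov basis, \<open>A b\<^sub>i\<close> is \<open>b\<^bsub>i + 1\<^esub>\<close> unless \<open>i\<close> is the end of a chain (\<open>stop i\<close>), in which case
it is a combination of \<open>b\<^sub>0, \<dots>, b\<^sub>i\<close>. Such a combination consists of \<open>u\<^sub>i\<close>, supported on vectors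
that do not end a chain, of \<open>w\<^sub>i\<close>, supported on earlier ends, and of a multiple \<open>c + c'\<close> of
\<open>b\<^sub>i\<close>. The maps \<open>X\<^sub>1, X\<^sub>2, Y\<^sub>1, Y\<^sub>2\<close> kill everything except ends of chains, where \<open>X\<^sub>1 - X\<^sub>2\<close> is
\<open>u\<^sub>i + c b\<^sub>i\<close> and \<open>Y\<^sub>1 - Y\<^sub>2\<close> is \<open>c' b\<^sub>i\<close>, the sign of the coefficient deciding which of the two maps
is nonzero. They are idempotent since they kill \<open>u\<^sub>i\<close>. The remaining map \<open>W\<close> moves along chains and
from an end only to earlier ends, so it is nilpotent.
\<close>

lemma companion_decomposition:
  fixes A :: "(nat \<Rightarrow> 'f::field) \<Rightarrow> nat \<Rightarrow> 'f"
  assumes lin: "linear_on_seq A" and A: "\<And>v. A v \<in> initial_space n"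
    and two_units: "\<And>t::'f. \<exists>c c'. c \<in> {1, -1} \<and> c' \<in> {0, 1, -1} \<and> t = c + c'"
  obtains X1 X2 Y1 Y2 W where
    "\<And>L. L \<in> {X1, X2, Y1, Y2, W} \<Longrightarrow> linear_on_seq L \<and> (\<forall>v\<in>initial_space n. L v \<in> initial_space n)"
    "\<And>v. v \<in> initial_space n \<Longrightarrow> X1 (X1 v) = X1 v \<and> X2 (X2 v) = X2 v \<and> X1 (X2 v) = 0 \<and> X2 (X1 v) = 0"
    "\<And>v. v \<in> initial_space n \<Longrightarrow> Y1 (Y1 v) = Y1 v \<and> Y2 (Y2 v) = Y2 v \<and> Y1 (Y2 v) = 0 \<and> Y2 (Y1 v) = 0"
    "\<And>v. v \<in> initial_space n \<Longrightarrow> (W ^^ (2 * n)) v = 0"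
    "\<And>v. v \<in> initial_space n \<Longrightarrow> A v = X1 v - X2 v + Y1 v - Y2 v + W v"
proof -
  obtain b k where k: "k \<le> n" and inj: "inj_on b {..<k}"
    and indep: "\<not> seq.dependent (b ` {..<k})"
    and span: "seq.span (b ` {..<k}) = initial_space n"
    and step: "\<And>i. i < k \<Longrightarrow> A (b i) \<in> seq.span (b ` {..i}) \<or> Suc i < k \<and> b (Suc i) = A (b i)"
    using exists_krylov_basis[of A n, OF A] by metis
  define stop where "stop i \<longleftrightarrow> A (b i) \<in> seq.span (b ` {..i})" for i
  have bV: "b i \<in> initial_space n" if "i < k" for i
    using that seq.span_base[of "b i" "b ` {..<k}"] span by blast
  have go: "Suc i < k \<and> b (Suc i) = A (b i)" if "i < k" "\<not> stop i" for i
    using step[OF that(1)] that(2) by (auto simp: stop_def)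
  have "\<exists>a. A (b i) = (\<Sum>j\<le>i. fscale (a j) (b j))" if i: "i < k" "stop i" for i
  proof -
    obtain a where "A (b i) = (\<Sum>v\<in>b ` {..i}. fscale (a v) v)"
      using i(2) seq.span_finite[of "b ` {..i}"] by (auto simp: stop_def)
    moreover have "inj_on b {..i}" using inj by (rule inj_on_subset) (use i in auto)
    ultimately have "A (b i) = (\<Sum>j\<le>i. fscale (a (b j)) (b j))" by (simp add: sum.reindex)
    thus ?thesis by (rule exI[of _ "\<lambda>j. a (b j)"])
  qed
  then obtain a where a: "\<And>i. i < k \<Longrightarrow> stop i \<Longrightarrow> A (b i) = (\<Sum>j\<le>i. fscale (a i j) (b j))"
    by metis
  obtain c c' where c: "\<And>t::'f. c t \<in> {1, -1}" "\<And>t. c' t \<in> {0, 1, -1}" "\<And>t. t = c t + c' t"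
    using two_units by metis
  define u where "u i = (\<Sum>j\<in>{j. j < i \<and> \<not> stop j}. fscale (a i j) (b j))" for i
  define w where "w i = (\<Sum>j\<in>{j. j < i \<and> stop j}. fscale (a i j) (b j))" for i
  have A_stop: "A (b i) = u i + w i + fscale (a i i) (b i)" if "i < k" "stop i" for i
  proof -
    have "{..i} = insert i ({j. j < i \<and> \<not> stop j} \<union> {j. j < i \<and> stop j})" by auto
    moreover have "sum g (insert i ({j. j < i \<and> \<not> stop j} \<union> {j. j < i \<and> stop j})) = g i +
        (sum g {j. j < i \<and> \<not> stop j} + sum g {j. j < i \<and> stop j})" for g :: "nat \<Rightarrow> nat \<Rightarrow> 'f"
      by (subst sum.insert) (auto intro!: sum.union_disjoint)
    ultimately show ?thesis using a[OF that] by (simp add: u_def w_def algebra_simps)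
  qed
  have ext: "\<exists>L. linear_on_seq L \<and> (\<forall>i<k. L (b i) = g i)" for g :: "nat \<Rightarrow> nat \<Rightarrow> 'f"
    using seq.linear_independent_extend[OF indep, of "\<lambda>v. g (inv_into {..<k} b v)"] inj
    by (auto simp: inv_into_f_f)
  have ext2: "\<exists>L. linear_on_seq L \<and> (\<forall>i<k. L (b i) = (if Q i then g i else 0))" for Q g
    using ext[of "\<lambda>i. if Q i then g i else 0"] .
  obtain X1 where X1: "linear_on_seq X1"
    "\<And>i. i < k \<Longrightarrow> X1 (b i) = (if stop i \<and> c (a i i) = 1 then u i + b i else 0)"
    using ext2[of "\<lambda>i. stop i \<and> c (a i i) = 1" "\<lambda>i. u i + b i"] by blast
  obtain X2 where X2: "linear_on_seq X2"
    "\<And>i. i < k \<Longrightarrow> X2 (b i) = (if stop i \<and> c (a i i) \<noteq> 1 then b i - u i else 0)"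
    using ext2[of "\<lambda>i. stop i \<and> c (a i i) \<noteq> 1" "\<lambda>i. b i - u i"] by blast
  obtain Y1 where Y1: "linear_on_seq Y1"
    "\<And>i. i < k \<Longrightarrow> Y1 (b i) = (if stop i \<and> c' (a i i) = 1 then b i else 0)"
    using ext2[of "\<lambda>i. stop i \<and> c' (a i i) = 1" b] by blast
  obtain Y2 where Y2: "linear_on_seq Y2"
    "\<And>i. i < k \<Longrightarrow> Y2 (b i) = (if stop i \<and> c' (a i i) \<noteq> 1 \<and> c' (a i i) \<noteq> 0 then b i else 0)"
    using ext2[of "\<lambda>i. stop i \<and> c' (a i i) \<noteq> 1 \<and> c' (a i i) \<noteq> 0" b] by blast
  obtain W where W: "linear_on_seq W" "\<And>i. i < k \<Longrightarrow> W (b i) = (if stop i then w i else b (Suc i))"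
    using ext[of "\<lambda>i. if stop i then w i else b (Suc i)"] by blast
  have uV: "u i \<in> initial_space n" and wV: "w i \<in> initial_space n" if "i < k" for i
    using that bV subspace_initial_space unfolding u_def w_def
    by (auto intro!: seq.subspace_sum seq.subspace_scale)
  have V: "L v \<in> initial_space n"
    if "linear_on_seq L" "\<And>i. i < k \<Longrightarrow> L (b i) \<in> initial_space n" "v \<in> initial_space n" for L v
  proof -
    have "seq.subspace {v. L v \<in> initial_space n}"
      using seq.linear_subspace_vimage[OF that(1) subspace_initial_space[of n]] by (simp add: vimage_def)
    hence "seq.span (b ` {..<k}) \<subseteq> {v. L v \<in> initial_space n}"
      using that(2) by (intro seq.span_minimal) auto
    thus ?thesis using span that(3) by blast
  qed
  have eqI: "L v = M v"
    if "linear_on_seq L" "linear_on_seq M" "\<And>i. i < k \<Longrightarrow> L (b i) = M (b i)" "v \<in> initial_space n"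
    for L M v
    using seq.linear_eq_on[OF that(1,2), of v "b ` {..<k}"] that(3,4) span by auto
  have comp: "linear_on_seq (\<lambda>v. L (M v))" if "linear_on_seq L" "linear_on_seq M" for L M
    using Vector_Spaces.linear_compose[OF that(2,1)] by (simp add: o_def)
  have kill: "L (u i) = 0"
    if "linear_on_seq L" "\<And>j. j < k \<Longrightarrow> \<not> stop j \<Longrightarrow> L (b j) = 0" "i < k" for L i
    unfolding u_def using that by (simp add: seq.linear_sum[OF that(1)] seq.linear_scale[OF that(1)])
  have X1u: "X1 (u i) = 0" and X2u: "X2 (u i) = 0" if "i < k" for i
    using kill[OF X1(1) _ that] kill[OF X2(1) _ that] X1(2) X2(2) by auto
  have zero: "linear_on_seq (\<lambda>v. 0 :: nat \<Rightarrow> 'f)" by (rule seq.linear_zero)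
  show thesis
  proof (rule that[of X1 X2 Y1 Y2 W])
    fix L assume "L \<in> {X1, X2, Y1, Y2, W}"
    moreover have "X1 v \<in> initial_space n" if "v \<in> initial_space n" for v
      by (rule V[OF X1(1) _ that]) (auto simp: X1(2) intro!: seq.subspace_0 seq.subspace_add subspace_initial_space uV bV)
    moreover have "X2 v \<in> initial_space n" if "v \<in> initial_space n" for v
      by (rule V[OF X2(1) _ that]) (auto simp: X2(2) intro!: seq.subspace_0 seq.subspace_diff subspace_initial_space uV bV)
    moreover have "Y1 v \<in> initial_space n" if "v \<in> initial_space n" for v
      by (rule V[OF Y1(1) _ that]) (auto simp: Y1(2) intro!: seq.subspace_0 subspace_initial_space bV)
    moreover have "Y2 v \<in> initial_space n" if "v \<in> initial_space n" for v
      by (rule V[OF Y2(1) _ that]) (auto simp: Y2(2) intro!: seq.subspace_0 subspace_initial_space bV)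
    moreover have "W v \<in> initial_space n" if "v \<in> initial_space n" for v
      by (rule V[OF W(1) _ that]) (use go in \<open>auto simp: W(2) intro!: A wV\<close>)
    ultimately show "linear_on_seq L \<and> (\<forall>v\<in>initial_space n. L v \<in> initial_space n)"
      using X1(1) X2(1) Y1(1) Y2(1) W(1) by auto
  next
    fix v :: "nat \<Rightarrow> 'f" assume v: "v \<in> initial_space n"
    have X1X1: "X1 (X1 v) = X1 v"
      by (rule eqI[OF comp[OF X1(1) X1(1)] X1(1) _ v])
         (simp add: X1(2) X1(2) X1u X2u seq.linear_add[OF X1(1)] seq.linear_diff[OF X1(1)] linear_zero_fun[OF X1(1)])
    have X2X2: "X2 (X2 v) = X2 v"
      by (rule eqI[OF comp[OF X2(1) X2(1)] X2(1) _ v])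
         (simp add: X2(2) X2(2) X1u X2u seq.linear_add[OF X2(1)] seq.linear_diff[OF X2(1)] linear_zero_fun[OF X2(1)])
    have X1X2: "X1 (X2 v) = 0"
      by (rule eqI[OF comp[OF X1(1) X2(1)] zero _ v])
         (simp add: X1(2) X2(2) X1u X2u seq.linear_add[OF X1(1)] seq.linear_diff[OF X1(1)] linear_zero_fun[OF X1(1)])
    have X2X1: "X2 (X1 v) = 0"
      by (rule eqI[OF comp[OF X2(1) X1(1)] zero _ v])
         (simp add: X2(2) X1(2) X1u X2u seq.linear_add[OF X2(1)] seq.linear_diff[OF X2(1)] linear_zero_fun[OF X2(1)])
    show "X1 (X1 v) = X1 v \<and> X2 (X2 v) = X2 v \<and> X1 (X2 v) = 0 \<and> X2 (X1 v) = 0"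
      using X1X1 X2X2 X1X2 X2X1 by blast
    have Y1Y1: "Y1 (Y1 v) = Y1 v"
      by (rule eqI[OF comp[OF Y1(1) Y1(1)] Y1(1) _ v])
         (simp add: Y1(2) Y1(2) X1u X2u seq.linear_add[OF Y1(1)] seq.linear_diff[OF Y1(1)] linear_zero_fun[OF Y1(1)])
    have Y2Y2: "Y2 (Y2 v) = Y2 v"
      by (rule eqI[OF comp[OF Y2(1) Y2(1)] Y2(1) _ v])
         (simp add: Y2(2) Y2(2) X1u X2u seq.linear_add[OF Y2(1)] seq.linear_diff[OF Y2(1)] linear_zero_fun[OF Y2(1)])
    have Y1Y2: "Y1 (Y2 v) = 0"
      by (rule eqI[OF comp[OF Y1(1) Y2(1)] zero _ v])
         (simp add: Y1(2) Y2(2) X1u X2u seq.linear_add[OF Y1(1)] seq.linear_diff[OF Y1(1)] linear_zero_fun[OF Y1(1)])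
    have Y2Y1: "Y2 (Y1 v) = 0"
      by (rule eqI[OF comp[OF Y2(1) Y1(1)] zero _ v])
         (simp add: Y2(2) Y1(2) X1u X2u seq.linear_add[OF Y2(1)] seq.linear_diff[OF Y2(1)] linear_zero_fun[OF Y2(1)])
    show "Y1 (Y1 v) = Y1 v \<and> Y2 (Y2 v) = Y2 v \<and> Y1 (Y2 v) = 0 \<and> Y2 (Y1 v) = 0"
      using Y1Y1 Y2Y2 Y1Y2 Y2Y1 by blast
    have sum: "linear_on_seq (\<lambda>v. X1 v - X2 v + Y1 v - Y2 v + W v)"
      by (intro seq.linear_compose_add seq.linear_compose_sub X1(1) X2(1) Y1(1) Y2(1) W(1))
    show "A v = X1 v - X2 v + Y1 v - Y2 v + W v"
    proof (rule eqI[OF lin sum _ v])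
      fix i assume i: "i < k"
      show "A (b i) = X1 (b i) - X2 (b i) + Y1 (b i) - Y2 (b i) + W (b i)"
      proof (cases "stop i")
        case True
        let ?t = "a i i"
        have "fscale ?t (b i) = fscale (c ?t) (b i) + fscale (c' ?t) (b i)"
          using c(3)[of ?t] by (metis seq.scale_left_distrib)
        moreover have "X1 (b i) - X2 (b i) = u i + fscale (c ?t) (b i)"
          using c(1)[of ?t] True i by (auto simp: X1(2) X2(2))
        moreover have "Y1 (b i) - Y2 (b i) = fscale (c' ?t) (b i)"
          using c(2)[of ?t] True i by (auto simp: Y1(2) Y2(2))
        ultimately show ?thesis using A_stop[OF i True] True i by (simp add: W(2) algebra_simps)
      next
        case False
        thus ?thesis using go[OF i False] i by (simp add: X1(2) X2(2) Y1(2) Y2(2) W(2))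
      qed
    qed
    have W0: "(W ^^ m) 0 = 0" for m by (rule linear_zero_fun[OF linear_funpow[OF W(1)]])
    have Wmono: "(W ^^ m) v = 0" if "(W ^^ l) v = 0" "l \<le> m" for l m v
      using that W0[of "m - l"] by (metis comp_apply funpow_add le_add_diff_inverse2)
    \<comment> \<open>From an end with index \<open>i\<close> at most \<open>i\<close> further ends can be reached.\<close>
    have Wstop: "(W ^^ l) (b i) = 0" if "i < l" "i < k" "stop i" for i l
      using that
    proof (induction l arbitrary: i)
      case (Suc l)
      have "(W ^^ l) (b j) = 0" if "j < i" "stop j" for j using that Suc by auto
      hence "(W ^^ l) (w i) = 0"
        by (simp add: w_def seq.linear_sum[OF linear_funpow[OF W(1)]] seq.linear_scale[OF linear_funpow[OF W(1)]])
      thus ?case using Suc.prems by (simp add: W(2) funpow_Suc_right del: funpow.simps)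
    qed simp
    \<comment> \<open>At most \<open>k - i\<close> steps lead from \<open>b i\<close> to an end, and \<open>k\<close> more steps lead to 0.\<close>
    have Wb: "(W ^^ (k - i + k)) (b i) = 0" if "i < k" for i
      using that
    proof (induction "k - i" arbitrary: i rule: less_induct)
      case less
      show ?case
      proof (cases "stop i")
        case True
        show ?thesis by (rule Wmono[OF Wstop[OF less.prems less.prems True]]) simp
      next
        case False
        have "(W ^^ (k - Suc i + k)) (b (Suc i)) = 0"
          using go[OF less.prems False] by (intro less.hyps) auto
        moreover have "k - i + k = Suc (k - Suc i + k)" using less.prems by simp
        ultimately show ?thesis
          using less.prems False by (simp add: W(2) funpow_Suc_right del: funpow.simps)
      qed
    qed
    show "(W ^^ (2 * n)) v = 0"
    proof (rule eqI[OF linear_funpow[OF W(1)] zero _ v])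
      fix i assume i: "i < k"
      show "(W ^^ (2 * n)) (b i) = 0"
        by (rule Wmono[OF Wb[OF i]]) (use k in simp)
    qed
  qed
qed

section \<open>Matrices modulo the prime radical\<close>

text \<open>
Square matrices of size \<open>n\<close> are functions of two indices of which only the values below \<open>n\<close> matter;
this avoids carrier conditions when entries are chosen one by one.
\<close>

definition fmul :: "nat \<Rightarrow> (nat \<Rightarrow> nat \<Rightarrow> 'a::ring_1) \<Rightarrow> (nat \<Rightarrow> nat \<Rightarrow> 'a) \<Rightarrow> nat \<Rightarrow> nat \<Rightarrow> 'a" where
  "fmul n f g i k = (\<Sum>j<n. f i j * g j k)"

primrec fpow :: "nat \<Rightarrow> (nat \<Rightarrow> nat \<Rightarrow> 'a::ring_1) \<Rightarrow> nat \<Rightarrow> nat \<Rightarrow> nat \<Rightarrow> 'a" where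
  "fpow n f 0 = (\<lambda>i j. if i = j then 1 else 0)"
| "fpow n f (Suc m) = fmul n f (fpow n f m)"

definition orth_idem_mod ::
    "'a::ring_1 set \<Rightarrow> nat \<Rightarrow> (nat \<Rightarrow> nat \<Rightarrow> 'a) \<Rightarrow> (nat \<Rightarrow> nat \<Rightarrow> 'a) \<Rightarrow> bool" where
  "orth_idem_mod I n X Y \<longleftrightarrow> (\<forall>i<n. \<forall>k<n.
     cong_mod I (fmul n X X i k) (X i k) \<and> cong_mod I (fmul n Y Y i k) (Y i k) \<and>
     cong_mod I (fmul n X Y i k) 0 \<and> cong_mod I (fmul n Y X i k) 0)"

text \<open>
The exponent \<open>2 * n\<close> does not depend on \<open>I\<close>, so that the conditions for all prime ideals together give
the condition for their intersection.
\<close>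

definition clean_mod ::
    "'a::ring_1 set \<Rightarrow> nat \<Rightarrow> (nat \<Rightarrow> nat \<Rightarrow> 'a) \<Rightarrow> (nat \<Rightarrow> nat \<Rightarrow> 'a) \<Rightarrow> (nat \<Rightarrow> nat \<Rightarrow> 'a) \<Rightarrow>
     (nat \<Rightarrow> nat \<Rightarrow> 'a) \<Rightarrow> (nat \<Rightarrow> nat \<Rightarrow> 'a) \<Rightarrow> (nat \<Rightarrow> nat \<Rightarrow> 'a) \<Rightarrow> bool" where
  "clean_mod I n A X1 X2 Y1 Y2 W \<longleftrightarrow> orth_idem_mod I n X1 X2 \<and> orth_idem_mod I n Y1 Y2 \<and>
     (\<forall>i<n. \<forall>k<n. cong_mod I (fpow n W (2 * n) i k) 0 \<and>
        cong_mod I (A i k) (X1 i k - X2 i k + Y1 i k - Y2 i k + W i k))"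

lemma fmul_of_int:
  "of_int (fmul n F G i k) = fmul n (\<lambda>i j. of_int (F i j)) (\<lambda>i j. of_int (G i j)) i k"
  by (simp add: fmul_def)

lemma fmul_cong_mod:
  assumes I: "two_sided_ideal I" and "i < n" "k < n"
    and "\<And>i k. i < n \<Longrightarrow> k < n \<Longrightarrow> cong_mod I (f i k) (f' i k)"
    and "\<And>i k. i < n \<Longrightarrow> k < n \<Longrightarrow> cong_mod I (g i k) (g' i k)"
  shows "cong_mod I (fmul n f g i k) (fmul n f' g' i k)"
  unfolding fmul_def using assms by (intro cong_mod_sum cong_mod_mult) auto

lemma fpow_cong_mod:
  assumes I: "two_sided_ideal I" and "i < n" "k < n"
    and f: "\<And>i k. i < n \<Longrightarrow> k < n \<Longrightarrow> cong_mod I (f i k) (f' i k)"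
  shows "cong_mod I (fpow n f m i k) (fpow n f' m i k)"
  using assms(2,3)
proof (induction m arbitrary: i k)
  case 0
  show ?case by (simp add: cong_mod_refl[OF I])
next
  case (Suc m)
  thus ?case by (auto intro!: fmul_cong_mod[OF I] f)
qed

lemma fpow_of_int:
  "of_int (fpow n F m i k) = fpow n (\<lambda>i j. of_int (F i j)) m i k"
  by (induction m arbitrary: i k) (simp_all add: fmul_of_int)

text \<open>
A decomposition over the integers modulo \<open>p\<close> is transported to any ring in which \<open>p\<close> lies in \<open>I\<close>, since
matrix products respect entrywise congruence.
\<close>

lemma clean_mod_of_int:
  fixes A :: "nat \<Rightarrow> nat \<Rightarrow> 'a::ring_1"
  assumes I: "two_sided_ideal I" and p: "of_int p \<in> I"
    and clean: "clean_mod {z. p dvd z} n C X1 X2 Y1 Y2 W"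
    and A: "\<And>i k. i < n \<Longrightarrow> k < n \<Longrightarrow> cong_mod I (A i k) (of_int (C i k))"
    and x1: "\<And>i k. i < n \<Longrightarrow> k < n \<Longrightarrow> cong_mod I (x1 i k) (of_int (X1 i k))"
    and x2: "\<And>i k. i < n \<Longrightarrow> k < n \<Longrightarrow> cong_mod I (x2 i k) (of_int (X2 i k))"
    and y1: "\<And>i k. i < n \<Longrightarrow> k < n \<Longrightarrow> cong_mod I (y1 i k) (of_int (Y1 i k))"
    and y2: "\<And>i k. i < n \<Longrightarrow> k < n \<Longrightarrow> cong_mod I (y2 i k) (of_int (Y2 i k))"
    and w: "\<And>i k. i < n \<Longrightarrow> k < n \<Longrightarrow> cong_mod I (w i k) (of_int (W i k))"
  shows "clean_mod I n A x1 x2 y1 y2 w"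
proof -
  have via: "cong_mod I x y"
    if "cong_mod I x (of_int a)" "cong_mod I y (of_int b)" "cong_mod {z. p dvd z} a b" for x y a b
    using that cong_mod_of_int[OF I p, of a b]
    by (auto simp: cong_mod_def[of "{z. p dvd z}"] intro: cong_mod_trans[OF I] cong_mod_sym[OF I])
  have zero: "cong_mod I 0 (of_int 0)" by (simp add: cong_mod_refl[OF I])
  have orth: "orth_idem_mod I n f g"
    if FG: "orth_idem_mod {z. p dvd z} n F G"
      and f: "\<And>i k. i < n \<Longrightarrow> k < n \<Longrightarrow> cong_mod I (f i k) (of_int (F i k))"
      and g: "\<And>i k. i < n \<Longrightarrow> k < n \<Longrightarrow> cong_mod I (g i k) (of_int (G i k))" for f g F G
    unfolding orth_idem_mod_def
  proof (intro allI impI conjI)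
    fix i k assume ik: "i < n" "k < n"
    have FG': "cong_mod {z. p dvd z} (fmul n F F i k) (F i k)" "cong_mod {z. p dvd z} (fmul n G G i k) (G i k)"
      "cong_mod {z. p dvd z} (fmul n F G i k) 0" "cong_mod {z. p dvd z} (fmul n G F i k) 0"
      using FG ik by (auto simp: orth_idem_mod_def)
    show "cong_mod I (fmul n f f i k) (f i k)"
      by (rule via[OF _ f[OF ik] FG'(1)]) (unfold fmul_of_int, intro fmul_cong_mod[OF I ik] f)
    show "cong_mod I (fmul n g g i k) (g i k)"
      by (rule via[OF _ g[OF ik] FG'(2)]) (unfold fmul_of_int, intro fmul_cong_mod[OF I ik] g)
    show "cong_mod I (fmul n f g i k) 0"
      by (rule via[OF _ zero FG'(3)]) (unfold fmul_of_int, intro fmul_cong_mod[OF I ik] f g)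
    show "cong_mod I (fmul n g f i k) 0"
      by (rule via[OF _ zero FG'(4)]) (unfold fmul_of_int, intro fmul_cong_mod[OF I ik] f g)
  qed
  show ?thesis
    unfolding clean_mod_def
  proof (intro conjI allI impI)
    show "orth_idem_mod I n x1 x2"
      by (rule orth[OF _ x1 x2]) (use clean in \<open>simp_all add: clean_mod_def\<close>)
    show "orth_idem_mod I n y1 y2"
      by (rule orth[OF _ y1 y2]) (use clean in \<open>simp_all add: clean_mod_def\<close>)
  next
    fix i k assume ik: "i < n" "k < n"
    have pow: "cong_mod {z. p dvd z} (fpow n W (2 * n) i k) 0"
      and sum: "cong_mod {z. p dvd z} (C i k) (X1 i k - X2 i k + Y1 i k - Y2 i k + W i k)"
      using clean ik by (auto simp: clean_mod_def)
    show "cong_mod I (fpow n w (2 * n) i k) 0"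
      by (rule via[OF _ zero pow]) (unfold fpow_of_int, intro fpow_cong_mod[OF I ik] w)
    show "cong_mod I (A i k) (x1 i k - x2 i k + y1 i k - y2 i k + w i k)"
      by (rule via[OF A[OF ik] _ sum])
         (simp only: of_int_add of_int_diff, intro cong_mod_add[OF I] cong_mod_diff[OF I] x1 x2 y1 y2 w ik)
  qed
qed

lemma linear_apply_expansion:
  fixes L :: "(nat \<Rightarrow> 'f::field) \<Rightarrow> nat \<Rightarrow> 'f"
  assumes L: "linear_on_seq L" and v: "v \<in> initial_space n"
  shows "L v i = (\<Sum>j<n. L (unit_seq j) i * v j)"
proof -
  have "L v = (\<Sum>j<n. fscale (v j) (L (unit_seq j)))"
    by (subst initial_space_expansion[OF v])
       (simp add: seq.linear_sum[OF L] seq.linear_scale[OF L])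
  thus ?thesis by (simp add: sum_apply fscale_def mult.commute)
qed

lemma of_int_mod_ring_eq_0:
  assumes "of_int z = (0 :: 'q::prime_card mod_ring)"
  shows "int CARD('q) dvd z"
proof -
  have "of_int_mod_ring z = (0 :: 'q mod_ring)" using assms by (simp add: of_int_of_int_mod_ring)
  hence "z mod int CARD('q) = 0" by transfer
  thus ?thesis by auto
qed

text \<open>
Up to 5 elements, every residue is one of \<open>0, \<plusminus>1, \<plusminus>2\<close>, that is, \<open>1 - 1\<close>, \<open>1 + 0\<close>, \<open>-1 + 0\<close>,
\<open>1 + 1\<close> or \<open>-1 - 1\<close>.
\<close>

lemma mod_ring_sum_of_units:
  fixes t :: "'q::prime_card mod_ring"
  assumes "CARD('q) \<le> 5"
  shows "\<exists>c c'. c \<in> {1, -1} \<and> c' \<in> {0, 1, -1} \<and> t = c + c'"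
proof -
  obtain i where i: "i < CARD('q)" "t = of_nat i" using surj_of_nat_mod_ring by blast
  have "CARD('q) = 5" if "3 \<le> i"
  proof -
    have "\<not> prime (4 :: nat)" by (auto simp: prime_nat_iff intro!: exI[of _ 2])
    hence "CARD('q) \<noteq> 4" using prime_card[where 'a='q] by metis
    thus ?thesis using that i(1) assms by simp
  qed
  hence five: "(5 :: 'q mod_ring) = 0" if "3 \<le> i"
    using of_nat_card_eq_0[where 'a='q] that by simp
  have "i = 0 \<or> i = 1 \<or> i = 2 \<or> i = 3 \<or> i = 4" using i(1) assms by linarith
  moreover have "\<exists>c c'. c \<in> {1, -1} \<and> c' \<in> {0, 1, -1} \<and> t = c + c'" if "i = 0"
    by (rule exI[of _ 1], rule exI[of _ "-1"]) (simp add: i that)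
  moreover have "\<exists>c c'. c \<in> {1, -1} \<and> c' \<in> {0, 1, -1} \<and> t = c + c'" if "i = 1"
    by (rule exI[of _ 1], rule exI[of _ 0]) (simp add: i that)
  moreover have "\<exists>c c'. c \<in> {1, -1} \<and> c' \<in> {0, 1, -1} \<and> t = c + c'" if "i = 2"
    by (rule exI[of _ 1], rule exI[of _ 1]) (simp add: i that)
  moreover have "\<exists>c c'. c \<in> {1, -1} \<and> c' \<in> {0, 1, -1} \<and> t = c + c'" if "i = 3"
  proof -
    have "t = 5 + (- 1 + - 1)" by (simp add: i that)
    hence "t = - 1 + - 1" using five that by simp
    thus ?thesis by blast
  qed
  moreover have "\<exists>c c'. c \<in> {1, -1} \<and> c' \<in> {0, 1, -1} \<and> t = c + c'" if "i = 4"
  proof -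
    have "t = 5 + (- 1 + 0)" by (simp add: i that)
    hence "t = - 1 + 0" using five that by simp
    thus ?thesis by blast
  qed
  ultimately show ?thesis by blast
qed

lemma clean_mod_card:
  fixes C :: "nat \<Rightarrow> nat \<Rightarrow> int"
  assumes card: "CARD('q::prime_card) \<le> 5"
  shows "\<exists>X1 X2 Y1 Y2 W. clean_mod {z. int CARD('q) dvd z} n C X1 X2 Y1 Y2 W"
proof -
  define A :: "(nat \<Rightarrow> 'q mod_ring) \<Rightarrow> nat \<Rightarrow> 'q mod_ring" where
    "A v = (\<lambda>i. if i < n then \<Sum>j<n. of_int (C i j) * v j else 0)" for v
  have lin: "linear_on_seq A"
    by unfold_locales
       (auto simp: A_def fscale_def plus_fun_def fun_eq_iff algebra_simps sum.distrib sum_distrib_left)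
  have "A v \<in> initial_space n" for v by (simp add: A_def initial_space_def)
  note companion = companion_decomposition[OF lin this mod_ring_sum_of_units[OF card]]
  show ?thesis
  proof (rule companion)
    fix X1 X2 Y1 Y2 W :: "(nat \<Rightarrow> 'q mod_ring) \<Rightarrow> nat \<Rightarrow> 'q mod_ring"
    assume
      L: "\<And>L. L \<in> {X1, X2, Y1, Y2, W} \<Longrightarrow> linear_on_seq L \<and> (\<forall>v\<in>initial_space n. L v \<in> initial_space n)" and
      X: "\<And>v. v \<in> initial_space n \<Longrightarrow> X1 (X1 v) = X1 v \<and> X2 (X2 v) = X2 v \<and> X1 (X2 v) = 0 \<and> X2 (X1 v) = 0" and
      Y: "\<And>v. v \<in> initial_space n \<Longrightarrow> Y1 (Y1 v) = Y1 v \<and> Y2 (Y2 v) = Y2 v \<and> Y1 (Y2 v) = 0 \<and> Y2 (Y1 v) = 0" and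
      W: "\<And>v. v \<in> initial_space n \<Longrightarrow> (W ^^ (2 * n)) v = 0" and
      A: "\<And>v. v \<in> initial_space n \<Longrightarrow> A v = X1 v - X2 v + Y1 v - Y2 v + W v"
    define m where "m L i j = to_int_mod_ring (L (unit_seq j) i)" for L :: "(nat \<Rightarrow> 'q mod_ring) \<Rightarrow> nat \<Rightarrow> 'q mod_ring" and i j
    have m: "of_int (m L i j) = L (unit_seq j) i" for L i j
      by (simp add: m_def of_int_of_int_mod_ring)
    note unit = unit_seq_in_initial_space
    have mul: "of_int (fmul n (m L) (m M) i k) = L (M (unit_seq k)) i"
      if "L \<in> {X1, X2, Y1, Y2, W}" "M \<in> {X1, X2, Y1, Y2, W}" "k < n" for L M i k
    proof -
      have "linear_on_seq L" "M (unit_seq k) \<in> initial_space n"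
        using L[OF that(1)] L[OF that(2)] unit[OF that(3)] by auto
      from linear_apply_expansion[OF this, of i] show ?thesis by (simp add: fmul_def m)
    qed
    have "of_int (fpow n (m W) l i k) = (W ^^ l) (unit_seq k) i \<and> (W ^^ l) (unit_seq k) \<in> initial_space n"
      if "k < n" for l i k
      using that
    proof (induction l arbitrary: i)
      case 0
      thus ?case using unit by (simp add: unit_seq_def)
    next
      case (Suc l)
      hence "of_int (fpow n (m W) (Suc l) i k) = (\<Sum>j<n. W (unit_seq j) i * (W ^^ l) (unit_seq k) j)"
        by (simp add: fmul_def m)
      also have "\<dots> = W ((W ^^ l) (unit_seq k)) i"
        using L[of W] Suc by (intro linear_apply_expansion[symmetric]) auto
      finally show ?case using L[of W] Suc by simp
    qed
    hence pow: "of_int (fpow n (m W) (2 * n) i k) = (0 :: 'q mod_ring)" if "k < n" for i k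
      using that W[OF unit[OF that]] by (simp add: zero_fun_def)
    have cong: "cong_mod {z. int CARD('q) dvd z} a b" if "of_int a = (of_int b :: 'q mod_ring)" for a b
      using that of_int_mod_ring_eq_0[of "a - b", where 'q='q] by (simp add: cong_mod_def)
    have "clean_mod {z. int CARD('q) dvd z} n C (m X1) (m X2) (m Y1) (m Y2) (m W)"
      unfolding clean_mod_def orth_idem_mod_def
    proof (intro conjI allI impI; rule cong)
      fix i k assume ik: "i < n" "k < n"
      show "of_int (C i k) = (of_int (m X1 i k - m X2 i k + m Y1 i k - m Y2 i k + m W i k) :: 'q mod_ring)"
      proof -
        have "A (unit_seq k) i = of_int (C i k)"
          using ik by (simp add: A_def unit_seq_def if_distrib[of "\<lambda>x. _ * x"] cong: if_cong)
        thus ?thesis using A[OF unit[OF ik(2)]] by (simp add: m fun_diff_def plus_fun_def)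
      qed
    qed (simp_all add: mul m pow X[OF unit] Y[OF unit] zero_fun_def)
    thus ?thesis by blast
  qed
qed

text \<open>
Index types of prime cardinality for the fields with 3 and 5 elements; the type \<open>bool\<close> serves for the
field with 2 elements.
\<close>

typedef index3 = "{..<3::nat}" by (rule exI[of _ 0]) simp
typedef index5 = "{..<5::nat}" by (rule exI[of _ 0]) simp

lemma card_index3: "CARD(index3) = 3"
  using type_definition.card[OF type_definition_index3] by simp

lemma card_index5: "CARD(index5) = 5"
  using type_definition.card[OF type_definition_index5] by simp

lemma prime_5: "prime (5 :: nat)"
  unfolding prime_nat_iff
proof (intro conjI allI impI)
  fix m :: nat assume m: "m dvd 5"
  hence "m \<le> 5" by (intro dvd_imp_le) auto
  hence "m \<in> {0, 1, 2, 3, 4, 5}" by auto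
  thus "m = 1 \<or> m = 5" using m by auto
qed simp

instance index3 :: prime_card
  by standard (simp add: card_index3)

instance index5 :: prime_card
  by standard (simp add: card_index5 prime_5)

lemma clean_mod_exists:
  fixes C :: "nat \<Rightarrow> nat \<Rightarrow> int"
  assumes "p \<in> {2, 3, 5}"
  shows "\<exists>X1 X2 Y1 Y2 W. clean_mod {z. p dvd z} n C X1 X2 Y1 Y2 W"
proof -
  consider "p = 2" | "p = 3" | "p = 5" using assms by blast
  thus ?thesis
  proof cases
    case 1
    thus ?thesis using clean_mod_card[where 'q=bool, of n C] by simp
  next
    case 2
    thus ?thesis using clean_mod_card[where 'q=index3, of n C] by (simp add: card_index3)
  next
    case 3
    thus ?thesis using clean_mod_card[where 'q=index5, of n C] by (simp add: card_index5)
  qed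
qed

definition prime_radical :: "'a::ring_1 set" where
  "prime_radical = {x. \<forall>P. prime_ideal P \<longrightarrow> x \<in> P}"

text \<open>
The residues of the entries of \<open>A\<close> at a prime ideal determine an integral matrix \<open>C cs\<close>, for which a
decomposition modulo \<open>p\<close> is fixed. Interpolating the entries of these decompositions gives matrices
over the ring that are correct at every prime ideal simultaneously.
\<close>

lemma clean_mod_prime_radical:
  fixes A :: "nat \<Rightarrow> nat \<Rightarrow> 'a::ring_1"
  assumes fifth: "\<And>x::'a. x ^ 5 - x \<in> prime_radical" and char: "(120 :: 'a) \<in> prime_radical"
  shows "\<exists>x1 x2 y1 y2 w. clean_mod prime_radical n A x1 x2 y1 y2 w"
proof -
  define as where "as = map (\<lambda>l. A (l div n) (l mod n)) [0..<n * n]"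
  define C where "C cs i j = (cs ! (i * n + j) :: int)" for cs i j
  have "\<forall>p cs. \<exists>X1 X2 Y1 Y2 W. p \<in> {2, 3, 5} \<longrightarrow> clean_mod {z. p dvd z} n (C cs) X1 X2 Y1 Y2 W"
    using clean_mod_exists by metis
  then obtain X1 X2 Y1 Y2 W where
    clean: "\<And>p cs. p \<in> {2, 3, 5} \<Longrightarrow>
      clean_mod {z. p dvd z} n (C cs) (X1 p cs) (X2 p cs) (Y1 p cs) (Y2 p cs) (W p cs)"
    by metis
  have interp: "\<exists>x. \<forall>i k P p cs. two_sided_ideal P \<longrightarrow> has_residues P p as cs \<longrightarrow>
      cong_mod P (x i k) (of_int (X p cs i k))" for X :: "int \<Rightarrow> int list \<Rightarrow> nat \<Rightarrow> nat \<Rightarrow> int"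
  proof -
    have "\<exists>r. \<forall>P p cs. two_sided_ideal P \<longrightarrow> has_residues P p as cs \<longrightarrow>
        cong_mod P r (of_int (X p cs i k))" for i k
      using residue_interpolation[of as "\<lambda>p cs. X p cs i k"] by metis
    thus ?thesis by metis
  qed
  obtain x1 where x1: "\<forall>i k P p cs. two_sided_ideal P \<longrightarrow> has_residues P p as cs \<longrightarrow>
      cong_mod P (x1 i k) (of_int (X1 p cs i k))" using interp by blast
  obtain x2 where x2: "\<forall>i k P p cs. two_sided_ideal P \<longrightarrow> has_residues P p as cs \<longrightarrow>
      cong_mod P (x2 i k) (of_int (X2 p cs i k))" using interp by blast
  obtain y1 where y1: "\<forall>i k P p cs. two_sided_ideal P \<longrightarrow> has_residues P p as cs \<longrightarrow>
      cong_mod P (y1 i k) (of_int (Y1 p cs i k))" using interp by blast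
  obtain y2 where y2: "\<forall>i k P p cs. two_sided_ideal P \<longrightarrow> has_residues P p as cs \<longrightarrow>
      cong_mod P (y2 i k) (of_int (Y2 p cs i k))" using interp by blast
  obtain w where w: "\<forall>i k P p cs. two_sided_ideal P \<longrightarrow> has_residues P p as cs \<longrightarrow>
      cong_mod P (w i k) (of_int (W p cs i k))" using interp by blast
  have local: "clean_mod P n A x1 x2 y1 y2 w" if P: "prime_ideal P" for P
  proof -
    note idP = prime_ideal_ideal[OF P]
    have "x ^ 5 - x \<in> P" "120 \<in> P" for x
      using fifth char P by (auto simp: prime_radical_def)
    from prime_ideal_residue_field[OF P this]
    obtain p where p: "p \<in> {2, 3, 5}" "of_int p \<in> P"
      and res: "\<And>x. \<exists>c. 0 \<le> c \<and> c < p \<and> cong_mod P x (of_int c)" by blast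
    obtain c where c: "\<And>x. 0 \<le> c x \<and> c x < p \<and> cong_mod P x (of_int (c x))"
      using res by metis
    define cs where "cs = map c as"
    have cs: "has_residues P p as cs"
      using p c by (simp add: has_residues_def cs_def list_all2_map2 list_all2_refl)
    have A: "cong_mod P (A i k) (of_int (C cs i k))" if ik: "i < n" "k < n" for i k
    proof -
      have "i * n + k < n * n"
      proof -
        have "i * n + k < Suc i * n" using ik by simp
        also have "\<dots> \<le> n * n" using ik by (intro mult_right_mono) auto
        finally show ?thesis .
      qed
      hence "C cs i k = c (A i k)" using ik by (simp add: C_def cs_def as_def)
      thus ?thesis using c by metis
    qed
    show ?thesis
      by (rule clean_mod_of_int[OF idP p(2) clean[OF p(1), of cs] A])
         (rule x1[rule_format, OF idP cs] x2[rule_format, OF idP cs] y1[rule_format, OF idP cs]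
            y2[rule_format, OF idP cs] w[rule_format, OF idP cs] | assumption)+
  qed
  have cong_iff: "cong_mod prime_radical a b \<longleftrightarrow> (\<forall>P. prime_ideal P \<longrightarrow> cong_mod P a b)" for a b :: 'a
    by (auto simp: cong_mod_def prime_radical_def)
  have "clean_mod prime_radical n A x1 x2 y1 y2 w"
    using local by (simp add: clean_mod_def orth_idem_mod_def cong_iff)
  thus ?thesis by blast
qed

section \<open>Lifting tripotent matrices\<close>

text \<open>
After lifting \<open>b\<^sub>1\<close> to \<open>g\<^sub>1\<close>, the element \<open>b' = (1 - g\<^sub>1) b\<^sub>2 (1 - g\<^sub>1)\<close> is congruent to \<open>b\<^sub>2\<close>. Lifting it
within the annihilator of \<open>g\<^sub>1\<close> makes the second idempotent orthogonal to the first.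
\<close>

lemma orthogonal_idempotents_lifting:
  fixes b1 b2 :: "'a::{ring,monoid_mult}"
  assumes Sdiff: "\<And>x y. x \<in> S \<Longrightarrow> y \<in> S \<Longrightarrow> x - y \<in> S"
    and Smult: "\<And>x y. x \<in> S \<Longrightarrow> y \<in> S \<Longrightarrow> x * y \<in> S"
    and KS: "K \<subseteq> S" and Kdiff: "\<And>x y. x \<in> K \<Longrightarrow> y \<in> K \<Longrightarrow> x - y \<in> K"
    and Kmult: "\<And>x y. x \<in> S \<Longrightarrow> y \<in> K \<Longrightarrow> x * y \<in> K \<and> y * x \<in> K"
    and nil: "\<And>x. x \<in> K \<Longrightarrow> nilpotent x"
    and b: "b1 \<in> S" "b2 \<in> S" "b1 * b1 - b1 \<in> K" "b2 * b2 - b2 \<in> K" "b1 * b2 \<in> K" "b2 * b1 \<in> K"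
  shows "\<exists>g1\<in>S. \<exists>g2\<in>S. g1 * g1 = g1 \<and> g2 * g2 = g2 \<and> g1 * g2 = 0 \<and> g2 * g1 = 0 \<and>
    g1 - b1 \<in> K \<and> g2 - b2 \<in> K"
proof -
  have K0: "0 \<in> K" using Kdiff[OF b(3) b(3)] by simp
  have Kadd: "x + y \<in> K" if "x \<in> K" "y \<in> K" for x y
    using Kdiff[OF that(1) Kdiff[OF K0 that(2)]] by simp
  have Sadd: "x + y \<in> S" if "x \<in> S" "y \<in> S" for x y
    using Sdiff[OF that(1) Sdiff[OF _ that(2)], of 0] K0 KS by auto
  obtain g1 where g1: "g1 \<in> S" "g1 * g1 = g1" "g1 - b1 \<in> K"
    using idempotent_lifting[of S K b1, OF Sdiff Smult KS Kdiff Kmult b(1,3) nil[OF b(3)]] by blast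
  have "(g1 - b1) * b2 + b1 * b2 \<in> K" using Kmult[OF b(2) g1(3)] b(5) Kadd by blast
  hence k1: "g1 * b2 \<in> K" by (simp add: left_diff_distrib)
  have "b2 * (g1 - b1) + b2 * b1 \<in> K" using Kmult[OF b(2) g1(3)] b(6) Kadd by blast
  hence k2: "b2 * g1 \<in> K" by (simp add: right_diff_distrib)
  have k3: "g1 * b2 * g1 \<in> K" using Kmult[OF g1(1) k1] by blast
  define d where "d = g1 * b2 * g1 - g1 * b2 - b2 * g1"
  define b' where "b' = b2 + d"
  have d: "d \<in> K" unfolding d_def by (rule Kdiff[OF Kdiff[OF k3 k1] k2])
  have b'S: "b' \<in> S" unfolding b'_def using b(2) d KS Sadd by blast
  have dS: "d \<in> S" using d KS by blast
  note Kd = Kmult[OF b(2) d, THEN conjunct1] Kmult[OF b(2) d, THEN conjunct2] Kmult[OF dS d, THEN conjunct1]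
  have "(b2 * b2 - b2) + (b2 * d + (d * b2 + (d * d - d))) \<in> K"
    by (rule Kadd[OF b(4) Kadd[OF Kd(1) Kadd[OF Kd(2) Kdiff[OF Kd(3) d]]]])
  also have "(b2 * b2 - b2) + (b2 * d + (d * b2 + (d * d - d))) = b' * b' - b'"
    by (simp add: b'_def algebra_simps)
  finally have defect: "b' * b' - b' \<in> K" .
  have gg: "g1 * (g1 * z) = g1 * z" for z using g1(2) by (metis mult.assoc)
  have orth: "g1 * b' = 0" "b' * g1 = 0"
    using g1(2) gg by (simp_all add: b'_def d_def distrib_left distrib_right left_diff_distrib right_diff_distrib mult.assoc)
  have ann: "g1 * (x * y) = 0" "x * y * g1 = 0" if "g1 * x = 0" "y * g1 = 0" for x y
    using that by (metis mult.assoc mult_zero_left mult_zero_right)+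
  let ?S = "{s \<in> S. g1 * s = 0 \<and> s * g1 = 0}" and ?K = "{s \<in> K. g1 * s = 0 \<and> s * g1 = 0}"
  have "\<exists>g\<in>?S. g * g = g \<and> g - b' \<in> ?K"
  proof (rule idempotent_lifting)
    show "x - y \<in> ?S" if "x \<in> ?S" "y \<in> ?S" for x y
      using that Sdiff by (simp add: left_diff_distrib right_diff_distrib)
    show "x * y \<in> ?S" if "x \<in> ?S" "y \<in> ?S" for x y
      using that Smult by (simp add: ann)
    show "?K \<subseteq> ?S" using KS by blast
    show "x - y \<in> ?K" if "x \<in> ?K" "y \<in> ?K" for x y
      using that Kdiff by (simp add: left_diff_distrib right_diff_distrib)
    show "x * y \<in> ?K \<and> y * x \<in> ?K" if "x \<in> ?S" "y \<in> ?K" for x y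
      using that Kmult by (simp add: ann)
    show "b' \<in> ?S" using b'S orth by simp
    show "b' * b' - b' \<in> ?K"
      using defect orth ann[OF orth] by (simp add: left_diff_distrib right_diff_distrib)
    show "nilpotent (b' * b' - b')" by (rule nil[OF defect])
  qed
  then obtain g2 where g2: "g2 \<in> S" "g1 * g2 = 0" "g2 * g1 = 0" "g2 * g2 = g2" "g2 - b' \<in> K" by blast
  have "(g2 - b') + d \<in> K" using g2(5) d Kadd by blast
  hence "g2 - b2 \<in> K" by (simp add: b'_def)
  thus ?thesis using g1 g2 by blast
qed

text \<open>
The matrices of a given size do not form a type when the size is a variable. Letting them act on
sequences embeds them into one ring, the endomorphism ring of the additive group of sequences, to
which the lifting lemmas apply.
\<close>

typedef (overloaded) 'v endo = "{f :: 'v::ab_group_add \<Rightarrow> 'v. \<forall>x y. f (x + y) = f x + f y}"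
  by (rule exI[of _ id]) simp

setup_lifting type_definition_endo

instantiation endo :: (ab_group_add) "{ring, monoid_mult}"
begin
lift_definition zero_endo :: "'a endo" is "\<lambda>_. 0" by simp
lift_definition one_endo :: "'a endo" is "\<lambda>x. x" by simp
lift_definition plus_endo :: "'a endo \<Rightarrow> 'a endo \<Rightarrow> 'a endo" is "\<lambda>f g x. f x + g x" by simp
lift_definition minus_endo :: "'a endo \<Rightarrow> 'a endo \<Rightarrow> 'a endo" is "\<lambda>f g x. f x - g x" by simp
lift_definition uminus_endo :: "'a endo \<Rightarrow> 'a endo" is "\<lambda>f x. - f x" by simp
lift_definition times_endo :: "'a endo \<Rightarrow> 'a endo \<Rightarrow> 'a endo" is "\<lambda>f g x. f (g x)" by simp
instance by standard (transfer; simp add: fun_eq_iff)+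
end

lift_definition act :: "nat \<Rightarrow> (nat \<Rightarrow> nat \<Rightarrow> 'a::ring_1) \<Rightarrow> (nat \<Rightarrow> 'a) endo" is
  "\<lambda>n f v i. if i < n then \<Sum>j<n. f i j * v j else 0"
  by (auto simp: plus_fun_def fun_eq_iff distrib_left sum.distrib)

lemma act_eq_iff: "act n f = act n g \<longleftrightarrow> (\<forall>i<n. \<forall>j<n. f i j = g i j)"
proof
  assume eq: "act n f = act n g"
  show "\<forall>i<n. \<forall>j<n. f i j = g i j"
  proof (intro allI impI)
    fix i j assume ij: "i < n" "j < n"
    have pick: "(\<Sum>l<n. h i l * (if l = j then 1 else 0)) = h i j" for h :: "nat \<Rightarrow> nat \<Rightarrow> 'a"
      using ij by (simp add: if_distrib[of "\<lambda>x. _ * x"] cong: if_cong)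
    have "(\<lambda>v i. if i < n then \<Sum>j<n. f i j * v j else 0) = (\<lambda>v i. if i < n then \<Sum>j<n. g i j * v j else 0)"
      using eq by transfer
    from fun_cong[OF fun_cong[OF this, of "\<lambda>l. if l = j then 1 else 0"], of i]
    show "f i j = g i j" using ij by (simp only: pick if_True)
  qed
next
  assume "\<forall>i<n. \<forall>j<n. f i j = g i j"
  thus "act n f = act n g" by transfer (auto simp: fun_eq_iff intro!: sum.cong)
qed

lemma act_mult: "act n (fmul n f g) = act n f * act n g"
proof (transfer, intro ext)
  fix n and f g :: "nat \<Rightarrow> nat \<Rightarrow> 'a" and v :: "nat \<Rightarrow> 'a" and i
  show "(if i < n then \<Sum>j<n. fmul n f g i j * v j else 0) =
      (if i < n then \<Sum>j<n. f i j * (if j < n then \<Sum>l<n. g j l * v l else 0) else 0)"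
  proof (cases "i < n")
    case True
    have "(\<Sum>j<n. fmul n f g i j * v j) = (\<Sum>j<n. \<Sum>l<n. f i l * g l j * v j)"
      by (simp add: fmul_def sum_distrib_right)
    also have "\<dots> = (\<Sum>l<n. \<Sum>j<n. f i l * g l j * v j)" by (rule sum.swap)
    also have "\<dots> = (\<Sum>l<n. f i l * (\<Sum>j<n. g l j * v j))"
      by (simp add: sum_distrib_left mult.assoc)
    finally show ?thesis using True by simp
  qed simp
qed

lemma act_diff: "act n (\<lambda>i j. f i j - g i j) = act n f - act n g"
  by transfer (auto simp: fun_eq_iff left_diff_distrib sum_subtractf)

lemma act_zero: "act n (\<lambda>i j. 0) = 0"
  by transfer (simp add: fun_eq_iff)

lemma act_fpow: "act n (fpow n f m) = act n f ^ m * act n (fpow n f 0)"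
  by (induction m) (simp_all add: act_mult mult.assoc del: fpow.simps(1))

lemma fmul_id_left: "i < n \<Longrightarrow> fmul n (fpow n f 0) g i k = g i k"
  by (simp add: fmul_def if_distrib[of "\<lambda>x. x * _"] cong: if_cong)

lemma fmul_id_right: "k < n \<Longrightarrow> fmul n g (fpow n f 0) i k = g i k"
  by (simp add: fmul_def if_distrib[of "\<lambda>x. _ * x"] cong: if_cong)

lemma act_id: "act n (fpow n f 0) * act n g = act n g" "act n g * act n (fpow n f 0) = act n g"
  unfolding act_mult[symmetric] act_eq_iff
  by (simp_all add: fmul_id_left fmul_id_right del: fpow.simps)

lemma nilpotent_act_iff:
  "nilpotent (act n f) \<longleftrightarrow> (\<exists>m. \<forall>i<n. \<forall>k<n. fpow n f m i k = 0)"
proof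
  assume "nilpotent (act n f)"
  then obtain m where "act n f ^ m = 0" by (auto simp: nilpotent_def)
  hence "act n (fpow n f m) = act n (\<lambda>i j. 0)"
    by (simp only: act_fpow[of n f m] act_zero mult_zero_left)
  thus "\<exists>m. \<forall>i<n. \<forall>k<n. fpow n f m i k = 0" unfolding act_eq_iff by blast
next
  assume "\<exists>m. \<forall>i<n. \<forall>k<n. fpow n f m i k = 0"
  then obtain m where "act n (fpow n f m) = act n (\<lambda>i j. 0)" unfolding act_eq_iff by blast
  hence "act n f ^ m * act n (fpow n f 0) = 0"
    by (simp only: act_fpow[of n f m] act_zero)
  hence "act n f ^ m * act n (fpow n f 0) * act n f = 0" by simp
  hence "act n f ^ Suc m = 0" by (simp add: mult.assoc act_id power_commutes del: fpow.simps)
  thus "nilpotent (act n f)" unfolding nilpotent_def by blast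
qed

text \<open>
The entries of powers are sums of words in the finitely many entries, and long words vanish because
the prime radical is locally nilpotent. The induction carries a prefix \<open>w\<close> of the words along.
\<close>

lemma nilpotent_act_prime_radical:
  fixes f :: "nat \<Rightarrow> nat \<Rightarrow> 'a::ring_1"
  assumes f: "\<And>i j. i < n \<Longrightarrow> j < n \<Longrightarrow> f i j \<in> prime_radical"
  shows "nilpotent (act n f)"
proof -
  let ?T = "(\<lambda>(i, j). f i j) ` ({..<n} \<times> {..<n})"
  obtain N where N: "\<And>w. set w \<subseteq> ?T \<Longrightarrow> length w = N \<Longrightarrow> prod_list w = 0"
  proof (rule prime_radical_locally_nilpotent[of ?T])
    show "x \<in> P" if "prime_ideal P" "x \<in> ?T" for P x
      using f that by (auto simp: prime_radical_def)
  qed auto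
  have "prod_list w * fpow n f m i k = 0"
    if "set w \<subseteq> ?T" "length w + m = N" "i < n" for w m i k
    using that
  proof (induction m arbitrary: w i)
    case 0
    thus ?case using N[of w] by simp
  next
    case (Suc m)
    have "prod_list w * (f i j * fpow n f m j k) = 0" if "j < n" for j
      using Suc.IH[of "w @ [f i j]" j] Suc.prems that by (auto simp: mult.assoc)
    thus ?case by (simp add: fmul_def sum_distrib_left)
  qed
  from this[of "[]" N] show ?thesis unfolding nilpotent_act_iff by auto
qed

lemma ideal_prime_radical: "two_sided_ideal prime_radical"
  unfolding two_sided_ideal_def
  by (simp add: prime_radical_def prime_ideal_ideal ideal_zero ideal_add ideal_mult_left ideal_mult_right)

lemma tripotent_difference:
  fixes g1 g2 :: "'a::ring"
  assumes "g1 * g1 = g1" "g2 * g2 = g2" "g1 * g2 = 0" "g2 * g1 = 0"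
  shows "(g1 - g2) * ((g1 - g2) * (g1 - g2)) = g1 - g2"
proof -
  have "(g1 - g2) * (g1 - g2) = g1 + g2"
    using assms by (simp add: left_diff_distrib right_diff_distrib)
  moreover have "(g1 - g2) * (g1 + g2) = g1 - g2"
    using assms by (simp add: left_diff_distrib distrib_left)
  ultimately show ?thesis by (simp only:)
qed

lemma tripotent_matrix_lifting:
  fixes x1 x2 :: "nat \<Rightarrow> nat \<Rightarrow> 'a::ring_1"
  assumes orth: "orth_idem_mod prime_radical n x1 x2"
  obtains e where "\<And>i k. i < n \<Longrightarrow> k < n \<Longrightarrow> fmul n e (fmul n e e) i k = e i k"
    "\<And>i k. i < n \<Longrightarrow> k < n \<Longrightarrow> cong_mod prime_radical (e i k) (x1 i k - x2 i k)"
proof -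
  let ?N = "prime_radical :: 'a set"
  note N = ideal_prime_radical[where 'a='a]
  let ?S = "range (act n) :: (nat \<Rightarrow> 'a) endo set"
  let ?K = "act n ` {f. \<forall>i<n. \<forall>k<n. f i k \<in> ?N}"
  have K_iff: "act n f \<in> ?K \<longleftrightarrow> (\<forall>i<n. \<forall>k<n. f i k \<in> ?N)" for f
    by (auto simp: image_iff act_eq_iff)
  have K_fmul: "fmul n f g i k \<in> ?N"
    if "(\<forall>i<n. \<forall>k<n. f i k \<in> ?N) \<or> (\<forall>i<n. \<forall>k<n. g i k \<in> ?N)" "i < n" "k < n" for f g i k
    using that ideal_mult_left[OF N] ideal_mult_right[OF N] by (auto simp: fmul_def intro!: ideal_sum[OF N])
  have "\<exists>g1\<in>?S. \<exists>g2\<in>?S. g1 * g1 = g1 \<and> g2 * g2 = g2 \<and> g1 * g2 = 0 \<and> g2 * g1 = 0 \<and>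
      g1 - act n x1 \<in> ?K \<and> g2 - act n x2 \<in> ?K"
  proof (rule orthogonal_idempotents_lifting)
    show "x - y \<in> ?S" if "x \<in> ?S" "y \<in> ?S" for x y
      using that by (auto simp flip: act_diff)
    show "x * y \<in> ?S" if "x \<in> ?S" "y \<in> ?S" for x y
      using that by (auto simp flip: act_mult)
    show "?K \<subseteq> ?S" by blast
    show "x - y \<in> ?K" if xy: "x \<in> ?K" "y \<in> ?K" for x y
    proof -
      obtain f g where "x = act n f" "y = act n g" using xy by blast
      thus ?thesis using xy ideal_diff[OF N] by (simp add: K_iff flip: act_diff)
    qed
    show "x * y \<in> ?K \<and> y * x \<in> ?K" if xy: "x \<in> ?S" "y \<in> ?K" for x y
    proof -
      obtain f g where "x = act n f" "y = act n g" using xy by blast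
      thus ?thesis using xy K_fmul by (simp add: K_iff flip: act_mult)
    qed
    show "nilpotent x" if "x \<in> ?K" for x
      using that nilpotent_act_prime_radical by blast
    show "act n x1 \<in> ?S" "act n x2 \<in> ?S" by blast+
    show "act n x1 * act n x1 - act n x1 \<in> ?K" "act n x2 * act n x2 - act n x2 \<in> ?K"
      "act n x1 * act n x2 \<in> ?K" "act n x2 * act n x1 \<in> ?K"
      unfolding act_mult[symmetric] act_diff[symmetric] K_iff
      using orth by (auto simp: orth_idem_mod_def cong_mod_def)
  qed
  then obtain e1 e2 where idem: "act n e1 * act n e1 = act n e1" "act n e2 * act n e2 = act n e2"
      "act n e1 * act n e2 = 0" "act n e2 * act n e1 = 0"
    and K: "act n e1 - act n x1 \<in> ?K" "act n e2 - act n x2 \<in> ?K"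
    by blast
  have c: "cong_mod ?N (e1 i k) (x1 i k)" "cong_mod ?N (e2 i k) (x2 i k)" if "i < n" "k < n" for i k
    using K that unfolding act_diff[symmetric] K_iff by (auto simp: cong_mod_def)
  show thesis
  proof (rule that[of "\<lambda>i k. e1 i k - e2 i k"])
    fix i k assume ik: "i < n" "k < n"
    let ?e = "\<lambda>i k. e1 i k - e2 i k"
    have "act n (fmul n ?e (fmul n ?e ?e)) = act n ?e"
      unfolding act_mult act_diff by (rule tripotent_difference[OF idem])
    thus "fmul n ?e (fmul n ?e ?e) i k = ?e i k" using ik unfolding act_eq_iff by blast
    show "cong_mod ?N (e1 i k - e2 i k) (x1 i k - x2 i k)"
      by (rule cong_mod_diff[OF N c[OF ik]])
  qed
qed

lemma matrix_clean_decomposition: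
  fixes A :: "nat \<Rightarrow> nat \<Rightarrow> 'a::ring_1"
  assumes zhou: "zhou_nil_clean TYPE('a)" and bounded: "bounded_index TYPE('a)" and n: "n \<ge> 1"
  shows "\<exists>e f w m. (\<forall>i<n. \<forall>k<n. fmul n e (fmul n e e) i k = e i k \<and> fmul n f (fmul n f f) i k = f i k \<and>
    fpow n w m i k = 0 \<and> A i k = e i k + f i k + w i k)"
proof -
  let ?N = "prime_radical :: 'a set"
  note N = ideal_prime_radical[where 'a='a]
  have nil5: "nilpotent (x ^ 5 - x)" for x :: 'a
    by (rule zhou_nil_clean_nilpotent_diff[OF zhou])
  have "x \<in> ?N" if "nilpotent x" for x
    using nilpotent_in_prime_ideal[OF nil5 bounded that] by (simp add: prime_radical_def)
  hence "x ^ 5 - x \<in> ?N" "120 \<in> ?N" for x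
    using nil5 zhou_nil_clean_nilpotent_120[OF zhou] by blast+
  from clean_mod_prime_radical[OF this, of n A]
  obtain x1 x2 y1 y2 w where clean: "clean_mod ?N n A x1 x2 y1 y2 w" by blast
  hence x: "orth_idem_mod ?N n x1 x2" and y: "orth_idem_mod ?N n y1 y2"
    and w: "\<And>i k. i < n \<Longrightarrow> k < n \<Longrightarrow> cong_mod ?N (fpow n w (2 * n) i k) 0"
    and A: "\<And>i k. i < n \<Longrightarrow> k < n \<Longrightarrow>
      cong_mod ?N (A i k) (x1 i k - x2 i k + y1 i k - y2 i k + w i k)"
    by (auto simp: clean_mod_def)
  obtain e where e: "\<And>i k. i < n \<Longrightarrow> k < n \<Longrightarrow> fmul n e (fmul n e e) i k = e i k"
    "\<And>i k. i < n \<Longrightarrow> k < n \<Longrightarrow> cong_mod ?N (e i k) (x1 i k - x2 i k)"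
    using tripotent_matrix_lifting[OF x] by metis
  obtain f where f: "\<And>i k. i < n \<Longrightarrow> k < n \<Longrightarrow> fmul n f (fmul n f f) i k = f i k"
    "\<And>i k. i < n \<Longrightarrow> k < n \<Longrightarrow> cong_mod ?N (f i k) (y1 i k - y2 i k)"
    using tripotent_matrix_lifting[OF y] by metis
  define v where "v i k = A i k - e i k - f i k" for i k
  have v: "cong_mod ?N (v i k) (w i k)" if ik: "i < n" "k < n" for i k
  proof -
    have "cong_mod ?N (v i k) ((x1 i k - x2 i k + y1 i k - y2 i k + w i k) - (x1 i k - x2 i k) - (y1 i k - y2 i k))"
      unfolding v_def by (intro cong_mod_diff[OF N] A[OF ik] e(2)[OF ik] f(2)[OF ik])
    thus ?thesis by simp
  qed
  have "cong_mod ?N (fpow n v (2 * n) i k) 0" if ik: "i < n" "k < n" for i k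
    by (rule cong_mod_trans[OF N fpow_cong_mod[OF N ik] w[OF ik]]) (rule v)
  hence "nilpotent (act n (fpow n v (2 * n)))"
    by (intro nilpotent_act_prime_radical) (auto simp: cong_mod_def)
  moreover have "act n (fpow n v (2 * n)) = act n v ^ (2 * n)"
  proof -
    obtain l where "2 * n = Suc l" using n by (cases "2 * n") auto
    thus ?thesis unfolding act_fpow[of n v "2 * n"]
      by (simp add: power_Suc2 mult.assoc act_id del: power_Suc fpow.simps)
  qed
  ultimately have "nilpotent (act n v)" using n nilpotent_power_iff[of "2 * n" "act n v"] by simp
  then obtain m where "\<forall>i<n. \<forall>k<n. fpow n v m i k = 0" unfolding nilpotent_act_iff by blast
  thus ?thesis using e(1) f(1)
    by (intro exI[of _ e] exI[of _ f] exI[of _ v] exI[of _ m]) (simp add: v_def)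
qed

section \<open>Rings in which zero and one may coincide\<close>

text \<open>
The product of a ring with the field of 2 elements. It satisfies \<open>0 \<noteq> 1\<close> even if the given ring is
zero, inherits both hypotheses of the theorem, and maps onto the given ring by \<open>base\<close>.
\<close>

datatype 'a unital = Unital (base: 'a) (flag: "bool mod_ring")

instantiation unital :: ("{ring, monoid_mult}") ring_1
begin
definition "0 = Unital 0 0"
definition "1 = Unital 1 1"
definition "x + y = Unital (base x + base y) (flag x + flag y)"
definition "x - y = Unital (base x - base y) (flag x - flag y)"
definition "- x = Unital (- base x) (- flag x)"
definition "x * y = Unital (base x * base y) (flag x * flag y)"
instance
  by standard
    (simp_all add: zero_unital_def one_unital_def plus_unital_def minus_unital_def uminus_unital_def
      times_unital_def algebra_simps)
end

lemma base_simps [simp]: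
  "base (0 :: 'a::{ring,monoid_mult} unital) = 0" "base (1 :: 'a unital) = 1"
  "base (x + y) = base x + base y" "base (x * y) = base x * base (y :: 'a unital)"
  by (simp_all add: zero_unital_def one_unital_def plus_unital_def times_unital_def)

lemma base_sum: "base (sum f S) = (\<Sum>i\<in>S. base (f i :: 'a::{ring,monoid_mult} unital))"
  by (induction S rule: infinite_finite_induct) simp_all

lemma unital_power: "Unital a b ^ n = Unital (a ^ n) (b ^ n)" for a :: "'a::{ring,monoid_mult}"
  by (induction n) (simp_all add: one_unital_def times_unital_def)

lemma nilpotent_unital: "nilpotent (Unital a b) \<longleftrightarrow> nilpotent a \<and> b = 0" for a :: "'a::{ring,monoid_mult}"
proof
  assume "nilpotent (Unital a b)"
  then obtain m where "Unital (a ^ m) (b ^ m) = 0" by (auto simp: nilpotent_def unital_power)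
  thus "nilpotent a \<and> b = 0" by (auto simp: zero_unital_def nilpotent_def)
next
  assume "nilpotent a \<and> b = 0"
  then obtain m where "a ^ m = 0" "b = 0" by (auto simp: nilpotent_def)
  hence "Unital a b ^ Suc m = 0" unfolding unital_power by (simp add: zero_unital_def)
  thus "nilpotent (Unital a b)" unfolding nilpotent_def by blast
qed

lemma zhou_nil_clean_unital:
  assumes "zhou_nil_clean TYPE('a::{ring,monoid_mult})"
  shows "zhou_nil_clean TYPE('a unital)"
  unfolding zhou_nil_clean_def
proof
  fix x :: "'a unital"
  obtain e f w where "tripotent e" "tripotent f" "nilpotent w" "e * f = f * e" "e * w = w * e"
    "f * w = w * f" "base x = e + f + w"
    using assms unfolding zhou_nil_clean_def by metis
  moreover have "flag x ^ 3 = flag x"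
  proof -
    obtain i where "i < 2" "flag x = of_nat i"
      using surj_of_nat_mod_ring[of "flag x"] by auto
    thus ?thesis by (cases "i = 0") (auto simp: less_2_cases_iff)
  qed
  ultimately show "\<exists>e f w. tripotent e \<and> tripotent f \<and> nilpotent w \<and> e * f = f * e \<and> e * w = w * e \<and>
      f * w = w * f \<and> x = e + f + w"
    by (intro exI[of _ "Unital e (flag x)"] exI[of _ "Unital f 0"] exI[of _ "Unital w 0"])
       (simp add: tripotent_def nilpotent_unital unital_power times_unital_def plus_unital_def unital.expand)
qed

lemma bounded_index_unital:
  assumes "bounded_index TYPE('a::{ring,monoid_mult})"
  shows "bounded_index TYPE('a unital)"
proof -
  obtain m where m: "\<And>x::'a. nilpotent x \<Longrightarrow> x ^ m = 0"
    using assms by (auto simp: bounded_index_def)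
  have "x ^ Suc m = 0" if "nilpotent x" for x :: "'a unital"
    using that m by (cases x) (simp add: nilpotent_unital unital_power zero_unital_def del: power_Suc, simp)
  thus ?thesis unfolding bounded_index_def by blast
qed

definition base_mat :: "nat \<Rightarrow> (nat \<Rightarrow> nat \<Rightarrow> 'a::{ring,monoid_mult} unital) \<Rightarrow> 'a mat" where
  "base_mat n f = mat n n (\<lambda>(i, k). base (f i k))"

lemma base_mat_mult: "base_mat n f * base_mat n g = base_mat n (fmul n f g)"
  by (rule eq_matI)
     (auto simp: base_mat_def fmul_def scalar_prod_def base_sum atLeast0LessThan intro!: sum.cong)

lemma base_mat_power: "mat_power n (base_mat n f) m = base_mat n (fpow n f m)"
proof (induction m)
  case 0
  show ?case by (rule eq_matI) (auto simp: mat_power_def base_mat_def)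
next
  case (Suc m)
  thus ?case by (simp add: mat_power_def base_mat_mult)
qed

theorem theorem3p7:
  fixes A :: "'a::{ring,monoid_mult} mat" and n :: nat
  assumes "zhou_nil_clean TYPE('a)"
    and "bounded_index TYPE('a)"
    and "n \<ge> 1"
    and "A \<in> carrier_mat n n"
  shows "\<exists>E\<in>carrier_mat n n. \<exists>F\<in>carrier_mat n n. \<exists>W\<in>carrier_mat n n.
           mat_tripotent n E \<and> mat_tripotent n F \<and> mat_nilpotent n W \<and> A = E + F + W"
proof -
  let ?A = "\<lambda>i k. Unital (A $$ (i, k)) 0"
  obtain e f w m where *: "\<forall>i<n. \<forall>k<n. fmul n e (fmul n e e) i k = e i k \<and>
      fmul n f (fmul n f f) i k = f i k \<and> fpow n w m i k = 0 \<and> ?A i k = e i k + f i k + w i k"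
    using matrix_clean_decomposition[OF zhou_nil_clean_unital[OF assms(1)]
        bounded_index_unital[OF assms(2)] assms(3), of ?A] by blast
  have efw: "fmul n e (fmul n e e) i k = e i k" "fmul n f (fmul n f f) i k = f i k"
    "fpow n w m i k = 0" "?A i k = e i k + f i k + w i k" if "i < n" "k < n" for i k
    using * that by blast+
  have cong: "base_mat n g = base_mat n h" if "\<And>i k. i < n \<Longrightarrow> k < n \<Longrightarrow> g i k = h i k" for g h :: "nat \<Rightarrow> nat \<Rightarrow> 'a unital"
    using that by (intro eq_matI) (auto simp: base_mat_def)
  have carrier: "base_mat n g \<in> carrier_mat n n" for g :: "nat \<Rightarrow> nat \<Rightarrow> 'a unital"
    by (simp add: base_mat_def)
  have tri: "mat_tripotent n (base_mat n g)"
    if "\<And>i k. i < n \<Longrightarrow> k < n \<Longrightarrow> fmul n g (fmul n g g) i k = g i k" for g :: "nat \<Rightarrow> nat \<Rightarrow> 'a unital"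
  proof -
    have "base_mat n (fpow n g 1) = base_mat n g"
      by (rule cong) (simp add: fmul_id_right del: fpow.simps(1))
    hence "mat_power n (base_mat n g) 3 = base_mat n g * (base_mat n g * base_mat n g)"
      using base_mat_power[of n g 1] by (simp add: mat_power_def numeral_3_eq_3)
    also have "\<dots> = base_mat n g" unfolding base_mat_mult by (rule cong[OF that])
    finally show ?thesis by (simp add: mat_tripotent_def)
  qed
  have "mat_power n (base_mat n w) m = 0\<^sub>m n n"
    unfolding base_mat_power by (rule eq_matI) (auto simp: base_mat_def efw(3))
  hence "mat_nilpotent n (base_mat n w)" by (auto simp: mat_nilpotent_def)
  moreover have "A = base_mat n e + base_mat n f + base_mat n w"
  proof (rule eq_matI)
    fix i k assume "i < dim_row (base_mat n e + base_mat n f + base_mat n w)"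
      "k < dim_col (base_mat n e + base_mat n f + base_mat n w)"
    hence ik: "i < n" "k < n" by (simp_all add: base_mat_def)
    have "A $$ (i, k) = base (e i k + f i k + w i k)" using efw(4)[OF ik] by (metis unital.sel(1))
    thus "A $$ (i, k) = (base_mat n e + base_mat n f + base_mat n w) $$ (i, k)"
      using ik by (simp add: base_mat_def)
  qed (use assms(4) in \<open>auto simp: base_mat_def\<close>)
  ultimately show ?thesis using tri[OF efw(1)] tri[OF efw(2)] carrier by blast
qed

end
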